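(* Let $(N,g)$ be a smooth compact $n$-dimensional Riemannian manifold, $1\le k\le n$, let $S$ be a $C^0$ symmetric $(0,2)$-tensor on $N$ with $S\in\Gamma_k^+$, and let $f:N\to(0,\infty)$ be smooth. Then there exist constants $\underline{\delta}<0<\overline{\delta}$ depending only upon $f$ and $S$ (for fixed $(N,g)$ and $k$) such that any $C^2$ solution $u$ of $$\sigma_k^{1/k}\left(\nabla^2u-du\otimes du+\frac{|\nabla u|^2}{2}g+S\right)=f(x)e^u$$ on $N$ satisfies $\underline{\delta}<u(x)<\overline{\delta}$ for all $x\in N$.
   Context: Compact means compact without boundary. On $\mathbf{R}^n$, $\sigma_k(\lambda_1,\dots,\lambda_n)=\sum_{i_1<\dots<i_k}\lambda_{i_1}\cdots\lambda_{i_k}$, and $\Gamma_k^+\subset\mathbf{R}^n$ is the connected component of $\{\sigma_k>0\}$ containing the positive cone. For a symmetric $(0,2)$-tensor $A$ on $(N,g)$, the eigenvalues of $A$ at a point are those of the symmetric endomorphism obtained by raising an index with $g$; $\sigma_k(A)$ is $\sigma_k$ of these eigenvalues, and $A\in\Gamma_k^+$ means that at every point the eigenvalues of $A$ lie in $\Gamma_k^+$. $\nabla u$, $\nabla^2u$ and $du$ denote the gradient, Hessian and differential of $u$ with respect to $g$. *)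

theory Defs
  imports "HOL-Analysis.Analysis"
begin

definition sigma_k :: "nat \<Rightarrow> real ^ 'n \<Rightarrow> real" where
  "sigma_k k l = (\<Sum>I\<in>{I. I \<subseteq> (UNIV :: 'n set) \<and> card I = k}. \<Prod>i\<in>I. l $ i)"

definition positive_cone :: "(real ^ 'n) set" where
  "positive_cone = {l. \<forall>i. 0 < l $ i}"

definition Gamma_plus :: "nat \<Rightarrow> (real ^ 'n) set" where
  "Gamma_plus k = (THE C. C \<in> components {l. 0 < sigma_k k l} \<and> positive_cone \<subseteq> C)"

lemma Gamma_plus_eq:
  assumes "k \<le> CARD('n::finite)"
  shows "Gamma_plus k =
    connected_component_set {l :: real ^ 'n. 0 < sigma_k k l} (\<chi> i. 1)" (is "_ = ?C")
proof -
  let ?P = "{l :: real ^ 'n. 0 < sigma_k k l}"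
  let ?one = "(\<chi> i. 1) :: real ^ 'n"
  obtain I0 :: "'n set" where I0: "card I0 = k"
    using obtain_subset_with_card_n[OF assms] by metis
  have pos: "positive_cone \<subseteq> ?P"
  proof
    fix l :: "real ^ 'n" assume l: "l \<in> positive_cone"
    have "0 < sigma_k k l"
      unfolding sigma_k_def
      by (rule sum_pos) (use l I0 in \<open>auto simp: positive_cone_def intro!: prod_pos\<close>)
    then show "l \<in> ?P" by simp
  qed
  have one: "?one \<in> positive_cone" by (simp add: positive_cone_def)
  have "convex (positive_cone :: (real ^ 'n) set)"
  proof (rule convexI)
    fix x y :: "real ^ 'n" and u v :: real
    assume *: "x \<in> positive_cone" "y \<in> positive_cone" "0 \<le> u" "0 \<le> v" "u + v = 1"
    have "0 < u * x $ i + v * y $ i" for i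
    proof (cases "u = 0")
      case False
      then have "0 < u * x $ i" "0 \<le> v * y $ i"
        using * by (auto simp: positive_cone_def less_imp_le)
      then show ?thesis by linarith
    qed (use * in \<open>auto simp: positive_cone_def\<close>)
    then show "u *\<^sub>R x + v *\<^sub>R y \<in> positive_cone"
      by (simp add: positive_cone_def)
  qed
  then have sub: "positive_cone \<subseteq> ?C"
    using connected_component_maximal[OF one convex_connected pos] by simp
  have comp: "?C \<in> components ?P"
    using one pos by (intro componentsI) auto
  show ?thesis
    unfolding Gamma_plus_def
  proof (rule the_equality)
    show "?C \<in> components ?P \<and> positive_cone \<subseteq> ?C"
      using comp sub by simp
    fix C assume "C \<in> components ?P \<and> positive_cone \<subseteq> C"
    then show "C = ?C"
      using comp sub one components_nonoverlap[of C ?P ?C] by blast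
  qed
qed

text \<open>Some listing of the eigenvalues, counted with multiplicity as roots of the characteristic
  polynomial. The order is immaterial because \<^const>\<open>sigma_k\<close> and \<^const>\<open>Gamma_plus\<close> are invariant under
  permutations of the coordinates. A listing by real numbers exists for every endomorphism that is
  symmetric with respect to some inner product; the definition is only used for such endomorphisms.\<close>

definition eigenvalues_of :: "real ^ 'n ^ 'n \<Rightarrow> real ^ 'n" where
  "eigenvalues_of M = (SOME l. \<forall>t. det (mat t - M) = (\<Prod>i\<in>UNIV. t - l $ i))"

primrec Ck_on :: "nat \<Rightarrow> 'a::real_normed_vector set \<Rightarrow> ('a \<Rightarrow> 'b::real_normed_vector) \<Rightarrow> bool" where
  "Ck_on 0 X h \<longleftrightarrow> continuous_on X h"
| "Ck_on (Suc m) X h \<longleftrightarrow> (\<forall>x\<in>X. h differentiable (at x)) \<and>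
     (\<forall>v. Ck_on m X (\<lambda>x. frechet_derivative h (at x) v))"

definition smooth_on :: "'a::real_normed_vector set \<Rightarrow> ('a \<Rightarrow> 'b::real_normed_vector) \<Rightarrow> bool" where
  "smooth_on X h \<longleftrightarrow> (\<forall>m. Ck_on m X h)"

definition pd :: "'n \<Rightarrow> (real ^ 'n \<Rightarrow> real) \<Rightarrow> real ^ 'n \<Rightarrow> real" where
  "pd i h x = frechet_derivative h (at x) (axis i 1)"

text \<open>The manifold is the whole type \<open>'a\<close>, which the theorem requires to be Hausdorff and
  second countable. A chart is a pair of its domain and its coordinate map; the images of charts
  are open in Euclidean space, so there is no boundary. The atlas need not be maximal.\<close>

type_synonym ('a, 'n) chart = "'a set \<times> ('a \<Rightarrow> real ^ 'n)"

definition is_chart :: "('a::topological_space, 'n::finite) chart \<Rightarrow> bool" where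
  "is_chart c \<longleftrightarrow> open (fst c) \<and> open (snd c ` fst c) \<and>
     homeomorphism (fst c) (snd c ` fst c) (snd c) (inv_into (fst c) (snd c))"

definition chart_inv :: "('a, 'n) chart \<Rightarrow> real ^ 'n \<Rightarrow> 'a" where
  "chart_inv c = inv_into (fst c) (snd c)"

definition smooth_atlas :: "('a::topological_space, 'n::finite) chart set \<Rightarrow> bool" where
  "smooth_atlas \<A> \<longleftrightarrow> (\<forall>c\<in>\<A>. is_chart c) \<and> (\<Union>c\<in>\<A>. fst c) = UNIV \<and>
     (\<forall>c\<in>\<A>. \<forall>d\<in>\<A>. smooth_on (snd c ` (fst c \<inter> fst d)) (snd d \<circ> chart_inv c))"

definition Ck_function :: "('a, 'n::finite) chart set \<Rightarrow> nat \<Rightarrow> ('a \<Rightarrow> real) \<Rightarrow> bool" where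
  "Ck_function \<A> m u \<longleftrightarrow> (\<forall>c\<in>\<A>. Ck_on m (snd c ` fst c) (u \<circ> chart_inv c))"

definition smooth_function :: "('a, 'n::finite) chart set \<Rightarrow> ('a \<Rightarrow> real) \<Rightarrow> bool" where
  "smooth_function \<A> u \<longleftrightarrow> (\<forall>m. Ck_function \<A> m u)"

text \<open>A (0,2)-tensor field \<open>T\<close> is given by its matrix of components \<open>T c p\<close> with respect to the
  coordinate basis of the chart \<open>c\<close> at each point \<open>p\<close> of the domain of \<open>c\<close>, subject to the
  transformation law of covariant tensors. Values for other \<open>c\<close> and \<open>p\<close> are irrelevant.\<close>

type_synonym ('a, 'n) tensor02 = "('a, 'n) chart \<Rightarrow> 'a \<Rightarrow> real ^ 'n ^ 'n"

definition tensor_field :: "('a, 'n::finite) chart set \<Rightarrow> ('a, 'n) tensor02 \<Rightarrow> bool" where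
  "tensor_field \<A> T \<longleftrightarrow> (\<forall>c\<in>\<A>. \<forall>d\<in>\<A>. \<forall>p\<in>fst c \<inter> fst d.
     let J = jacobian (snd d \<circ> chart_inv c) (at (snd c p))
     in T c p = transpose J ** T d p ** J)"

definition symmetric_tensor :: "('a, 'n::finite) chart set \<Rightarrow> ('a, 'n) tensor02 \<Rightarrow> bool" where
  "symmetric_tensor \<A> T \<longleftrightarrow> tensor_field \<A> T \<and>
     (\<forall>c\<in>\<A>. \<forall>p\<in>fst c. transpose (T c p) = T c p)"

definition Ck_tensor :: "('a, 'n::finite) chart set \<Rightarrow> nat \<Rightarrow> ('a, 'n) tensor02 \<Rightarrow> bool" where
  "Ck_tensor \<A> m T \<longleftrightarrow> (\<forall>c\<in>\<A>. Ck_on m (snd c ` fst c) (\<lambda>x. T c (chart_inv c x)))"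

definition riemannian_metric :: "('a, 'n::finite) chart set \<Rightarrow> ('a, 'n) tensor02 \<Rightarrow> bool" where
  "riemannian_metric \<A> g \<longleftrightarrow> symmetric_tensor \<A> g \<and> (\<forall>m. Ck_tensor \<A> m g) \<and>
     (\<forall>c\<in>\<A>. \<forall>p\<in>fst c. \<forall>v. v \<noteq> 0 \<longrightarrow> 0 < v \<bullet> (g c p *v v))"

definition differential :: "('a \<Rightarrow> real) \<Rightarrow> ('a, 'n::finite) chart \<Rightarrow> 'a \<Rightarrow> real ^ 'n" where
  "differential u c p = (\<chi> i. pd i (u \<circ> chart_inv c) (snd c p))"

definition gradient ::
  "('a, 'n::finite) tensor02 \<Rightarrow> ('a \<Rightarrow> real) \<Rightarrow> ('a, 'n) chart \<Rightarrow> 'a \<Rightarrow> real ^ 'n" where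
  "gradient g u c p = matrix_inv (g c p) *v differential u c p"

definition grad_norm_sq ::
  "('a, 'n::finite) tensor02 \<Rightarrow> ('a \<Rightarrow> real) \<Rightarrow> ('a, 'n) chart \<Rightarrow> 'a \<Rightarrow> real" where
  "grad_norm_sq g u c p = gradient g u c p \<bullet> (g c p *v gradient g u c p)"

definition metric_pd ::
  "('a, 'n::finite) tensor02 \<Rightarrow> ('a, 'n) chart \<Rightarrow> 'a \<Rightarrow> 'n \<Rightarrow> 'n \<Rightarrow> 'n \<Rightarrow> real" where
  "metric_pd g c p l i j = pd l (\<lambda>x. g c (chart_inv c x) $ i $ j) (snd c p)"

text \<open>\<open>christoffel g c p m i j\<close> is the Christoffel symbol of the Levi-Civita connection with upper
  index \<open>m\<close> and lower indices \<open>i\<close>, \<open>j\<close>.\<close>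

definition christoffel ::
  "('a, 'n::finite) tensor02 \<Rightarrow> ('a, 'n) chart \<Rightarrow> 'a \<Rightarrow> 'n \<Rightarrow> 'n \<Rightarrow> 'n \<Rightarrow> real" where
  "christoffel g c p m i j = (1 / 2) * (\<Sum>l\<in>UNIV. matrix_inv (g c p) $ m $ l *
     (metric_pd g c p i j l + metric_pd g c p j i l - metric_pd g c p l i j))"

definition hessian :: "('a, 'n::finite) tensor02 \<Rightarrow> ('a \<Rightarrow> real) \<Rightarrow> ('a, 'n) tensor02" where
  "hessian g u c p = (\<chi> i j. pd i (pd j (u \<circ> chart_inv c)) (snd c p)
     - (\<Sum>m\<in>UNIV. christoffel g c p m i j * differential u c p $ m))"

definition du_otimes_du :: "('a \<Rightarrow> real) \<Rightarrow> ('a, 'n::finite) tensor02" where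
  "du_otimes_du u c p = (\<chi> i j. differential u c p $ i * differential u c p $ j)"

definition raise_index :: "('a, 'n::finite) tensor02 \<Rightarrow> ('a, 'n) tensor02 \<Rightarrow>
    ('a, 'n) chart \<Rightarrow> 'a \<Rightarrow> real ^ 'n ^ 'n" where
  "raise_index g T c p = matrix_inv (g c p) ** T c p"

definition tensor_eigenvalues :: "('a, 'n::finite) tensor02 \<Rightarrow> ('a, 'n) tensor02 \<Rightarrow>
    ('a, 'n) chart \<Rightarrow> 'a \<Rightarrow> real ^ 'n" where
  "tensor_eigenvalues g T c p = eigenvalues_of (raise_index g T c p)"

definition in_Gamma_plus :: "('a, 'n::finite) chart set \<Rightarrow> ('a, 'n) tensor02 \<Rightarrow> nat \<Rightarrow>
    ('a, 'n) tensor02 \<Rightarrow> bool" where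
  "in_Gamma_plus \<A> g k T \<longleftrightarrow>
     (\<forall>c\<in>\<A>. \<forall>p\<in>fst c. tensor_eigenvalues g T c p \<in> Gamma_plus k)"

definition equation_tensor :: "('a, 'n::finite) tensor02 \<Rightarrow> ('a, 'n) tensor02 \<Rightarrow> ('a \<Rightarrow> real) \<Rightarrow>
    ('a, 'n) tensor02" where
  "equation_tensor g S u c p = hessian g u c p - du_otimes_du u c p
     + (grad_norm_sq g u c p / 2) *\<^sub>R g c p + S c p"

text \<open>\<^const>\<open>root\<close> is the odd real root on negative numbers, so for positive \<open>f\<close> the equation
  forces \<open>\<sigma>\<^sub>k > 0\<close>. The solution is not assumed to be admissible, that is, the eigenvalues are not
  required to lie in \<^const>\<open>Gamma_plus\<close>. The condition does not depend on the chart at a point.\<close>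

definition solves_equation :: "('a, 'n::finite) chart set \<Rightarrow> ('a, 'n) tensor02 \<Rightarrow> nat \<Rightarrow>
    ('a, 'n) tensor02 \<Rightarrow> ('a \<Rightarrow> real) \<Rightarrow> ('a \<Rightarrow> real) \<Rightarrow> bool" where
  "solves_equation \<A> g k S f u \<longleftrightarrow> (\<forall>c\<in>\<A>. \<forall>p\<in>fst c.
     root k (sigma_k k (tensor_eigenvalues g (equation_tensor g S u) c p)) = f p * exp (u p))"

end

theory Submission
  imports Defs "HOL-Computational_Algebra.Polynomial"
begin

text \<open>
  The bounds come from the maximum principle. At a minimum of \<open>u\<close> the gradient vanishes and the
  Hessian is nonnegative, so the left-hand side of the equation is at least \<open>\<sigma>\<^sub>k\<^sup>1\<^sup>/\<^sup>k(S)\<close> there,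
  provided \<open>\<sigma>\<^sub>k\<close> is monotone; at a maximum it is at most \<open>\<sigma>\<^sub>k\<^sup>1\<^sup>/\<^sup>k(S)\<close>. Hence \<open>e\<^sup>u\<close> lies between the
  minimum and the maximum of the continuous positive function \<open>\<sigma>\<^sub>k\<^sup>1\<^sup>/\<^sup>k(S)/f\<close> on the compact
  manifold, and these two numbers involve only \<open>f\<close>, \<open>S\<close>, \<open>g\<close> and \<open>k\<close>.

  Monotonicity of \<open>\<sigma>\<^sub>k\<close> holds only on \<open>\<Gamma>\<^sub>k\<^sup>+\<close>. At a minimum this suffices, because the tensor there is
  \<open>S\<close> plus a nonnegative form. At a maximum it is needed that the tensor of the equation itself lies
  in \<open>\<Gamma>\<^sub>k\<^sup>+\<close>, which is not part of the notion of a solution. It is automatic: the equation forces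
  \<open>\<sigma>\<^sub>k > 0\<close> everywhere, and \<open>\<Gamma>\<^sub>k\<^sup>+\<close> is open and closed in \<open>{\<sigma>\<^sub>k > 0}\<close>, so the set \<open>V\<close> of points where
  the tensor is outside \<open>\<Gamma>\<^sub>k\<^sup>+\<close> is open and compact. If \<open>V\<close> were nonempty, the minimum of \<open>u\<close> over
  \<open>V\<close> would be a local minimum of \<open>u\<close>, where the tensor does lie in \<open>\<Gamma>\<^sub>k\<^sup>+\<close>. This is
  \<open>admissible_everywhere\<close>; the two estimates are combined in \<open>solution_bounds\<close>.

  The cone is handled algebraically. The points at which all partial derivatives of \<open>\<sigma>\<^sub>k\<close> of order
  at most \<open>k\<close> are positive form an open and relatively closed subset of \<open>{\<sigma>\<^sub>k > 0}\<close>
  (\<open>esym_derivs_pos\<close>), so this subset contains \<open>\<Gamma>\<^sub>k\<^sup>+\<close>; it follows that \<open>\<Gamma>\<^sub>k\<^sup>+\<close> consists of the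
  points with \<open>\<sigma>\<^sub>1, \<dots>, \<sigma>\<^sub>k > 0\<close>. For symmetric matrices relative to a positive definite \<open>g\<close>, a
  nonnegative perturbation is a sum of rank-one terms, and a rank-one term
  changes every \<open>\<sigma>\<^sub>j\<close> by a nonnegative combination of first derivatives of \<open>\<sigma>\<^sub>j\<close>
  (\<open>sym_eig_rank_one\<close>). Openness and compactness need the \<open>\<sigma>\<^sub>j\<close> to be well defined and
  continuous on the manifold. Continuity holds because they are coefficients of a polynomial
  with continuous values; well-definedness amounts to tensoriality of the
  Hessian, that is, to the transformation law of the Christoffel symbols
  (\<open>christoffel_du_transform\<close>), and to the symmetry of second derivatives.
\<close>

section \<open>Elementary symmetric functions\<close>

text \<open>The index set is a parameter because deleting an index is the same as taking a partial
  derivative: the derivative of \<open>esym F (Suc m)\<close> in the \<open>i\<close>-th variable is \<open>esym (F - {i}) m\<close>.\<close>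

definition esym :: "'i set \<Rightarrow> nat \<Rightarrow> ('i \<Rightarrow> real) \<Rightarrow> real" where
  "esym F m l = (\<Sum>I\<in>{I. I \<subseteq> F \<and> card I = m}. \<Prod>i\<in>I. l i)"

lemma sigma_k_eq_esym: "sigma_k k l = esym UNIV k (($) l)"
  by (simp add: sigma_k_def esym_def)

lemma esym_0 [simp]: "finite F \<Longrightarrow> esym F 0 l = 1"
proof -
  assume "finite F"
  then have "{I. I \<subseteq> F \<and> card I = 0} = {{}}"
    using finite_subset[of _ F] by fastforce
  then show ?thesis by (simp add: esym_def)
qed

lemma esym_eq_0: "finite F \<Longrightarrow> card F < m \<Longrightarrow> esym F m l = 0"
proof -
  assume *: "finite F" "card F < m"
  have "card I \<noteq> m" if "I \<subseteq> F" for I using card_mono[OF *(1) that] *(2) by linarith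
  then have "{I. I \<subseteq> F \<and> card I = m} = {}" by blast
  then show ?thesis unfolding esym_def by (simp only: sum.empty)
qed

lemma esym_insert:
  assumes "finite F" "i \<notin> F"
  shows "esym (insert i F) (Suc m) l = esym F (Suc m) l + l i * esym F m l"
proof -
  let ?S = "\<lambda>F m. {I. I \<subseteq> F \<and> card I = m}"
  have fin: "finite (?S F m)" for m using assms by simp
  have split: "?S (insert i F) (Suc m) = ?S F (Suc m) \<union> insert i ` ?S F m"
  proof (intro equalityI subsetI)
    fix I assume I: "I \<in> ?S (insert i F) (Suc m)"
    then have fI: "finite I" using assms finite_subset by auto
    show "I \<in> ?S F (Suc m) \<union> insert i ` ?S F m"
    proof (cases "i \<in> I")
      case True
      then have "I = insert i (I - {i})" "I - {i} \<in> ?S F m" using I fI by auto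
      then show ?thesis by blast
    qed (use I in auto)
  next
    fix I assume "I \<in> ?S F (Suc m) \<union> insert i ` ?S F m"
    then show "I \<in> ?S (insert i F) (Suc m)"
    proof
      assume "I \<in> insert i ` ?S F m"
      then obtain J where J: "I = insert i J" "J \<subseteq> F" "card J = m" by auto
      moreover have "finite J" "i \<notin> J" using J assms finite_subset by auto
      ultimately show ?thesis by auto
    qed auto
  qed
  have disj: "?S F (Suc m) \<inter> insert i ` ?S F m = {}" using assms by auto
  have inj: "inj_on (insert i) (?S F m)"
  proof (rule inj_onI)
    fix I J assume "I \<in> ?S F m" "J \<in> ?S F m" "insert i I = insert i J"
    then show "I = J" using assms by (metis (mono_tags, lifting) insert_ident mem_Collect_eq subsetD)
  qed
  have "(\<Sum>I\<in>insert i ` ?S F m. prod l I) = (\<Sum>I\<in>?S F m. l i * prod l I)"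
    using assms by (subst sum.reindex[OF inj])
      (auto intro!: sum.cong prod.insert simp: finite_subset subset_iff)
  then show ?thesis
    unfolding esym_def split using fin disj
    by (subst sum.union_disjoint) (auto simp: sum_distrib_left)
qed

lemma esym_remove:
  assumes "finite F" "i \<in> F"
  shows "esym F (Suc m) l = esym (F - {i}) (Suc m) l + l i * esym (F - {i}) m l"
  using esym_insert[of "F - {i}" i m l] assms by (simp add: insert_absorb)

text \<open>Every \<open>m\<close>-subset of \<open>F\<close> survives the deletion of exactly those indices that it does not
  contain.\<close>

lemma esym_deletions:
  assumes "finite F"
  shows "(\<Sum>i\<in>F. esym (F - {i}) m l) = (real (card F) - real m) * esym F m l"
  using assms
proof (induction F arbitrary: m rule: finite_induct)
  case empty
  then show ?case by (cases m) (auto simp: esym_eq_0)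
next
  case (insert a F)
  have D: "insert a F - {i} = insert a (F - {i})" "a \<notin> F - {i}" if "i \<in> F" for i
    using that insert by auto
  show ?case
  proof (cases m)
    case 0
    then show ?thesis using insert by simp
  next
    case (Suc m')
    have "(\<Sum>i\<in>insert a F. esym (insert a F - {i}) m l)
        = esym F m l + (\<Sum>i\<in>F. esym (insert a (F - {i})) (Suc m') l)"
      using insert D by (simp add: Suc cong: sum.cong)
    also have "\<dots> = esym F m l + (\<Sum>i\<in>F. esym (F - {i}) (Suc m') l)
        + l a * (\<Sum>i\<in>F. esym (F - {i}) m' l)"
      using insert.hyps
      by (simp add: esym_insert sum.distrib sum_distrib_left del: insert_Diff_if)
    also have "\<dots> = (real (card (insert a F)) - real m) * esym (insert a F) m l"
      using insert by (simp add: insert.IH Suc esym_insert algebra_simps)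
    finally show ?thesis .
  qed
qed

text \<open>Euler's identity for the homogeneous polynomial \<open>esym F (Suc m)\<close>.\<close>

lemma esym_euler:
  assumes "finite F"
  shows "(\<Sum>i\<in>F. l i * esym (F - {i}) m l) = real (Suc m) * esym F (Suc m) l"
proof -
  have "(\<Sum>i\<in>F. l i * esym (F - {i}) m l)
      = (\<Sum>i\<in>F. esym F (Suc m) l - esym (F - {i}) (Suc m) l)"
    by (rule sum.cong) (use assms esym_remove[of F _ m l] in auto)
  also have "\<dots> = real (Suc m) * esym F (Suc m) l"
    using assms by (simp add: sum_subtractf esym_deletions algebra_simps)
  finally show ?thesis .
qed

lemma esym_shift_has_derivative:
  assumes "finite F"
  shows "((\<lambda>t. esym F (Suc m) (\<lambda>i. l i + t)) has_real_derivative
     (real (card F) - real m) * esym F m (\<lambda>i. l i + t)) (at t)"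
  using assms
proof (induction F arbitrary: m rule: finite_induct)
  case empty
  then show ?case by (cases m) (auto simp: esym_eq_0)
next
  case (insert a F)
  show ?case
  proof (cases m)
    case 0
    have "((\<lambda>t. esym F (Suc 0) (\<lambda>i. l i + t) + (l a + t)) has_real_derivative card F + 1) (at t)"
      using insert.IH[of 0] insert.hyps by (auto intro!: derivative_eq_intros)
    then show ?thesis using insert.hyps by (simp add: 0 esym_insert add.commute)
  next
    case (Suc m')
    have "((\<lambda>t. esym F (Suc m) (\<lambda>i. l i + t) + (l a + t) * esym F m (\<lambda>i. l i + t))
       has_real_derivative (real (card F) - real m) * esym F m (\<lambda>i. l i + t)
        + (esym F m (\<lambda>i. l i + t)
        + (l a + t) * ((real (card F) - real m') * esym F m' (\<lambda>i. l i + t)))) (at t)"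
      using insert.IH[of m] insert.IH[of m'] unfolding Suc
      by (auto intro!: derivative_eq_intros simp: algebra_simps)
    then show ?thesis using insert.hyps
      by (simp add: Suc esym_insert algebra_simps)
  qed
qed

text \<open>The derivative of \<open>\<sigma>\<^sub>m\<close> along the diagonal is a nonnegative multiple of \<open>\<sigma>\<^sub>m\<^sub>-\<^sub>1\<close>, so
  monotonicity along the diagonal passes from \<open>m - 1\<close> to \<open>m\<close>.\<close>

lemma esym_shift_mono:
  assumes "finite F" "t \<ge> 0" "\<And>j. j \<le> m \<Longrightarrow> 0 \<le> esym F j l"
  shows "esym F m l \<le> esym F m (\<lambda>i. l i + t)"
  using assms(2,3)
proof (induction m arbitrary: t)
  case 0
  then show ?case using assms by simp
next
  case (Suc m)
  have "\<exists>y. ((\<lambda>t. esym F (Suc m) (\<lambda>i. l i + t)) has_real_derivative y) (at s) \<and> 0 \<le> y"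
    if "0 \<le> s" "s \<le> t" for s
  proof (intro exI conjI)
    show "((\<lambda>t. esym F (Suc m) (\<lambda>i. l i + t)) has_real_derivative
     (real (card F) - real m) * esym F m (\<lambda>i. l i + s)) (at s)"
      by (rule esym_shift_has_derivative[OF assms(1)])
    have "0 \<le> esym F m l" "esym F m l \<le> esym F m (\<lambda>i. l i + s)"
      using Suc.prems Suc.IH[of s] that by auto
    then show "0 \<le> (real (card F) - real m) * esym F m (\<lambda>i. l i + s)"
      using esym_eq_0[OF assms(1), of m] by (cases "card F < m") auto
  qed
  then show ?case
    using DERIV_nonneg_imp_nondecreasing[of 0 t "\<lambda>t. esym F (Suc m) (\<lambda>i. l i + t)"] Suc.prems
    by auto
qed

lemma esym_pos: "finite F \<Longrightarrow> m \<le> card F \<Longrightarrow> (\<And>i. i \<in> F \<Longrightarrow> 0 < l i) \<Longrightarrow> 0 < esym F m l"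
proof -
  assume *: "finite F" "m \<le> card F" "\<And>i. i \<in> F \<Longrightarrow> 0 < l i"
  obtain J where "J \<subseteq> F" "card J = m" using obtain_subset_with_card_n[OF *(2)] by metis
  then show ?thesis unfolding esym_def
    by (intro sum_pos) (use * in \<open>auto intro!: prod_pos\<close>)
qed

lemma continuous_on_esym: "continuous_on A (\<lambda>x. esym F m (($) x))"
  unfolding esym_def by (intro continuous_intros)

section \<open>The cone as the set of positive symmetric functions\<close>

text \<open>The derivatives are shown to be positive one index at a
  time. Suppose that a derivative \<open>\<sigma>\<^sub>m\<^sub>+\<^sub>1\<close>, in the variables \<open>F \<union> {i}\<close>, is positive and that its
  derivative \<open>\<sigma>\<^sub>m\<close> in the direction \<open>i\<close>, a function of the variables \<open>F\<close>, vanishes. Then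
  \<open>\<sigma>\<^sub>m\<^sub>+\<^sub>1\<close> of \<open>F\<close> is positive. But Euler's identity writes a multiple of it as a sum of terms
  \<open>l\<^sub>j \<sigma>\<^sub>m(F - {j})\<close>, and each of them equals \<open>- l\<^sub>j\<^sup>2 \<sigma>\<^sub>m\<^sub>-\<^sub>1(F - {j})\<close> because \<open>\<sigma>\<^sub>m(F)\<close> vanishes,
  hence is not positive.\<close>

lemma esym_derivs_pos:
  fixes l :: "'i::finite \<Rightarrow> real"
  assumes nonneg: "\<And>I. card I \<le> k \<Longrightarrow> 0 \<le> esym (-I) (k - card I) l"
    and pos: "0 < esym UNIV k l" and "card I \<le> k"
  shows "0 < esym (-I) (k - card I) l"
proof -
  have "finite I" by simp
  then show ?thesis using \<open>card I \<le> k\<close>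
  proof (induction I rule: finite_induct)
    case empty
    then show ?case using pos by simp
  next
    case (insert i I)
    define m where "m = k - Suc (card I)"
    define F where "F = - insert i I"
    have cI: "Suc (card I) \<le> k" using insert by simp
    then have ki: "k - card I = Suc m" by (simp add: m_def)
    have "0 < esym (-I) (Suc m) l" using insert cI ki by simp
    moreover have "-I - {i} = F" "i \<in> -I" using insert by (auto simp: F_def)
    ultimately have P: "0 < esym F (Suc m) l + l i * esym F m l"
      using esym_remove[of "-I" i m l] by simp
    have nn: "0 \<le> esym F m l"
      using nonneg[of "insert i I"] insert by (simp add: F_def m_def)
    have "esym F m l \<noteq> 0"
    proof
      assume z: "esym F m l = 0"
      then obtain m' where m': "m = Suc m'" by (cases m) auto
      have "l j * esym (F - {j}) m l \<le> 0" if j: "j \<in> F" for j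
      proof -
        have "esym (F - {j}) m l = - (l j * esym (F - {j}) m' l)"
          using esym_remove[of F j m' l] z j unfolding m' by simp
        then have e: "l j * esym (F - {j}) m l = - ((l j)\<^sup>2 * esym (F - {j}) m' l)"
          by (simp add: power2_eq_square)
        have J: "F - {j} = - insert j (insert i I)" "card (insert j (insert i I)) = Suc (Suc (card I))"
          using j insert by (auto simp: F_def)
        have "Suc (Suc (card I)) \<le> k" "m' = k - Suc (Suc (card I))"
          using m' m_def by auto
        then have "0 \<le> esym (F - {j}) m' l"
          using nonneg[of "insert j (insert i I)"] J by simp
        then show ?thesis unfolding e by simp
      qed
      then have "real (Suc m) * esym F (Suc m) l \<le> 0"
        using esym_euler[of F l m] by (metis (no_types, lifting) finite sum_nonpos)
      then have "esym F (Suc m) l \<le> 0"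
        by (metis mult_le_0_iff not_less of_nat_0_less_iff zero_less_Suc)
      then show False using P z by simp
    qed
    then show ?case using nn insert by (simp add: F_def m_def)
  qed
qed

text \<open>Positivity of all partial derivatives of \<open>\<sigma>\<^sub>k\<close>, including \<open>\<sigma>\<^sub>k\<close> itself for \<open>I = {}\<close>.\<close>

definition esym_cone :: "nat \<Rightarrow> (real ^ 'n) set" where
  "esym_cone k = {l. \<forall>I. card I \<le> k \<longrightarrow> 0 < esym (-I) (k - card I) (($) l)}"

text \<open>Within \<open>{\<sigma>\<^sub>k > 0}\<close> the open cone coincides with the closed set in which the derivatives are only
  nonnegative, so it is a union of connected components.\<close>

lemma Gamma_plus_subset_esym_cone:
  assumes "k \<le> CARD('n)"
  shows "Gamma_plus k \<subseteq> (esym_cone k :: (real ^ 'n) set)"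
proof -
  let ?P = "{l :: real ^ 'n. 0 < sigma_k k l}"
  let ?one = "(\<chi> i. 1) :: real ^ 'n"
  let ?C = "connected_component_set ?P ?one"
  let ?W = "esym_cone k :: (real ^ 'n) set"
  let ?Wc = "{l :: real ^ 'n. \<forall>I. card I \<le> k \<longrightarrow> 0 \<le> esym (-I) (k - card I) (($) l)}"
  have one: "?one \<in> ?P" using assms by (auto simp: sigma_k_eq_esym intro!: esym_pos)
  have oneW: "?one \<in> ?W"
    unfolding esym_cone_def using assms
    by (auto intro!: esym_pos simp: Compl_eq_Diff_UNIV card_Diff_subset)
  have opW: "open ?W"
  proof -
    have "?W = (\<Inter>I\<in>{I. card I \<le> k}. {l. 0 < esym (-I) (k - card I) (($) l)})"
      by (auto simp: esym_cone_def)
    also have "open \<dots>"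
      by (intro open_INT ballI open_Collect_less continuous_on_esym continuous_on_const) auto
    finally show ?thesis .
  qed
  have clW: "closed ?Wc"
  proof -
    have "?Wc = (\<Inter>I\<in>{I. card I \<le> k}. {l. 0 \<le> esym (-I) (k - card I) (($) l)})" by auto
    also have "closed \<dots>"
      by (intro closed_INT ballI closed_Collect_le continuous_on_esym continuous_on_const)
    finally show ?thesis .
  qed
  have CP: "?C \<subseteq> ?P" by (rule connected_component_subset)
  have eq: "?C \<inter> ?W = ?C \<inter> ?Wc"
  proof (intro equalityI subsetI)
    fix l assume l: "l \<in> ?C \<inter> ?Wc"
    then have "0 < esym UNIV k (($) l)" using CP by (auto simp: sigma_k_eq_esym)
    then have "l \<in> ?W" unfolding esym_cone_def
      using esym_derivs_pos[of k "($) l"] l by blast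
    then show "l \<in> ?C \<inter> ?W" using l by blast
  qed (auto simp: esym_cone_def less_imp_le)
  have "openin (top_of_set ?C) (?C \<inter> ?W)" using opW by auto
  moreover have "closedin (top_of_set ?C) (?C \<inter> ?W)" unfolding eq
    by (rule closedin_closed_Int[OF clW])
  moreover have "?C \<inter> ?W \<noteq> {}"
    using one oneW by (metis Int_iff connected_component_refl empty_iff mem_Collect_eq)
  ultimately have "?C \<inter> ?W = ?C"
    using connected_clopen[of ?C] connected_connected_component[of ?P ?one] by blast
  then show ?thesis using Gamma_plus_eq[OF assms] by auto
qed

text \<open>Summing the derivatives of \<open>\<sigma>\<^sub>j\<^sub>+\<^sub>1\<close> over all variables gives a positive multiple of \<open>\<sigma>\<^sub>j\<close>.\<close>

lemma esym_cone_descend: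
  assumes "k \<le> CARD('n)" "(l :: real ^ 'n) \<in> esym_cone k" "j \<le> k"
  shows "l \<in> esym_cone j"
  using assms(3)
proof (induction "k - j" arbitrary: j)
  case 0
  then show ?case using assms by simp
next
  case (Suc d)
  then have IH: "l \<in> esym_cone (Suc j)" and jk: "Suc j \<le> k" by auto
  have "0 < esym (-I) (j - card I) (($) l)" if I: "card I \<le> j" for I :: "'n set"
  proof -
    let ?m = "j - card I"
    have c: "card (-I) = CARD('n) - card I" by (simp add: Compl_eq_Diff_UNIV card_Diff_subset)
    then have lt: "?m < card (-I)" using assms jk I by linarith
    then have ne: "-I \<noteq> {}" by auto
    have "0 < esym (-I - {i}) ?m (($) l)" if "i \<in> -I" for i
    proof -
      have "-I - {i} = - insert i I" "card (insert i I) = Suc (card I)" using that by auto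
      moreover have "card J \<le> Suc j \<Longrightarrow> 0 < esym (-J) (Suc j - card J) (($) l)" for J
        using IH unfolding esym_cone_def by blast
      ultimately show ?thesis using I by (metis Suc_le_mono diff_Suc_Suc)
    qed
    then have "0 < (\<Sum>i\<in>-I. esym (-I - {i}) ?m (($) l))"
      using ne by (intro sum_pos) auto
    then have "0 < (real (card (-I)) - real ?m) * esym (-I) ?m (($) l)"
      by (subst (asm) esym_deletions) auto
    then show ?thesis using lt by (simp add: zero_less_mult_iff)
  qed
  then show ?case by (simp add: esym_cone_def)
qed

lemma Gamma_plus_esym_pos:
  assumes "k \<le> CARD('n)" "(l :: real ^ 'n) \<in> Gamma_plus k" "j \<le> k"
  shows "0 < esym UNIV j (($) l)"
proof -
  have "l \<in> esym_cone j"
    using esym_cone_descend[OF assms(1) _ assms(3)] Gamma_plus_subset_esym_cone[OF assms(1)] assms by blast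
  then show ?thesis by (auto simp: esym_cone_def dest: spec[of _ "{}"])
qed

lemma Gamma_plus_esym_remove_pos:
  assumes "k \<le> CARD('n)" "(l :: real ^ 'n) \<in> Gamma_plus k" "Suc j \<le> k"
  shows "0 < esym (UNIV - {i}) j (($) l)"
proof -
  have "l \<in> esym_cone (Suc j)"
    using esym_cone_descend[OF assms(1) _ assms(3)] Gamma_plus_subset_esym_cone[OF assms(1)] assms by blast
  then show ?thesis
    by (auto simp: esym_cone_def Compl_eq_Diff_UNIV dest: spec[of _ "{i}"])
qed

text \<open>The diagonal ray from \<open>l\<close> stays in \<open>{\<sigma>\<^sub>k > 0}\<close> and ends in the positive cone. Allowing
  equality for \<open>j < k\<close> is what makes \<open>\<Gamma>\<^sub>k\<^sup>+\<close> relatively closed in \<open>{\<sigma>\<^sub>k > 0}\<close>.\<close>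

lemma Gamma_plusI:
  assumes "k \<le> CARD('n)" "\<And>j. j < k \<Longrightarrow> 0 \<le> esym UNIV j (($) l)" "0 < esym UNIV k (($) l)"
  shows "(l :: real ^ 'n) \<in> Gamma_plus k"
proof -
  let ?P = "{l :: real ^ 'n. 0 < sigma_k k l}"
  let ?one = "(\<chi> i. 1) :: real ^ 'n"
  let ?ray = "(\<lambda>t. l + t *\<^sub>R ?one) ` {0..}"
  have nn: "0 \<le> esym UNIV j (($) l)" if "j \<le> k" for j
    using assms(2)[of j] assms(3) that by (cases "j = k") auto
  have e: "($) (l + t *\<^sub>R ?one) = (\<lambda>i. l $ i + t)" for t by auto
  have ray: "?ray \<subseteq> ?P"
    using esym_shift_mono[of UNIV _ k "($) l"] nn assms(3)
    by (fastforce simp: sigma_k_eq_esym e)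
  have cray: "connected ?ray"
    by (intro connected_continuous_image continuous_intros) simp
  define T where "T = norm l + 1"
  have "positive_cone \<subseteq> (Gamma_plus k :: (real ^ 'n) set)"
  proof -
    have pos: "positive_cone \<subseteq> ?P"
      using assms by (auto simp: sigma_k_eq_esym positive_cone_def intro!: esym_pos)
    have "convex (positive_cone :: (real ^ 'n) set)"
    proof -
      have eq: "positive_cone = (\<Inter>i. {l :: real ^ 'n. axis i 1 \<bullet> l > 0})"
        by (auto simp: positive_cone_def inner_axis')
      show ?thesis unfolding eq by (intro convex_INT convex_halfspace_gt)
    qed
    moreover have "?one \<in> positive_cone" by (simp add: positive_cone_def)
    ultimately show ?thesis
      using connected_component_maximal[OF _ convex_connected pos] Gamma_plus_eq[OF assms(1)] by metis
  qed
  moreover have "l + T *\<^sub>R ?one \<in> positive_cone"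
  proof -
    have "0 < l $ i + T" for i using component_le_norm_cart[of l i] by (simp add: T_def)
    then show ?thesis by (simp add: positive_cone_def)
  qed
  ultimately have "l + T *\<^sub>R ?one \<in> connected_component_set ?P ?one"
    using Gamma_plus_eq[OF assms(1)] by blast
  moreover have "connected_component ?P (l + T *\<^sub>R ?one) l"
  proof (rule connected_componentI[OF cray ray])
    show "l + T *\<^sub>R ?one \<in> ?ray" by (auto simp: T_def)
    show "l \<in> ?ray" by (auto intro!: image_eqI[of _ _ 0])
  qed
  ultimately show ?thesis
    unfolding Gamma_plus_eq[OF assms(1)] by (auto intro: connected_component_trans)
qed

section \<open>Diagonalization of symmetric matrices\<close>

lemma dot_matrix_symmetric:
  fixes A :: "real ^ 'n ^ 'n"
  assumes "transpose A = A"
  shows "x \<bullet> (A *v y) = (A *v x) \<bullet> y"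
  using assms by (metis dot_lmul_matrix inner_commute vector_transpose_matrix)

text \<open>A maximizer of the Rayleigh quotient on the unit sphere of \<open>V\<close> is an eigenvector: otherwise moving
  in the direction of the residual \<open>A x - c x\<close>, which lies in \<open>V\<close>, would increase the quotient to
  first order.\<close>

lemma symmetric_eigenvector_in_invariant_subspace:
  fixes A :: "real ^ 'n ^ 'n"
  assumes sym: "transpose A = A" and V: "subspace V" and inv: "\<And>x. x \<in> V \<Longrightarrow> A *v x \<in> V"
    and ne: "V \<noteq> {0}"
  shows "\<exists>x\<in>V. norm x = 1 \<and> (\<exists>c. A *v x = c *\<^sub>R x)"
proof -
  let ?q = "\<lambda>x. x \<bullet> (A *v x)"
  let ?K = "V \<inter> sphere 0 1"
  obtain y where y: "y \<in> V" "y \<noteq> 0" using ne subspace_0[OF V] by auto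
  have "y /\<^sub>R norm y \<in> ?K" using y V by (simp add: subspace_scale)
  then have neK: "?K \<noteq> {}" by blast
  have comp: "compact ?K"
    by (intro closed_Int_compact closed_subspace V compact_sphere)
  have "continuous_on ?K ?q"
    by (intro continuous_intros linear_continuous_on matrix_vector_mul_bounded_linear)
  from continuous_attains_sup[OF comp neK this]
  obtain x where x: "x \<in> ?K" and max: "\<And>y. y \<in> ?K \<Longrightarrow> ?q y \<le> ?q x" by blast
  define c where "c = ?q x"
  have le: "?q y \<le> c * (y \<bullet> y)" if "y \<in> V" for y
  proof (cases "y = 0")
    case False
    have "y /\<^sub>R norm y \<in> ?K" using False that V by (simp add: subspace_scale)
    from max[OF this] have "?q y / (norm y * norm y) \<le> c"
      by (simp add: c_def matrix_vector_mult_scaleR divide_inverse mult_ac)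
    then show ?thesis using False by (simp add: pos_divide_le_eq flip: power2_norm_eq_inner power2_eq_square)
  qed simp
  have xV: "x \<in> V" and nx: "x \<bullet> x = 1" using x by (auto simp: norm_eq_1)
  define z where "z = A *v x - c *\<^sub>R x"
  have zV: "z \<in> V" using xV V inv by (simp add: z_def subspace_diff subspace_scale)
  have orth: "x \<bullet> z = 0" by (simp add: z_def inner_diff_right nx c_def)
  have bound: "2 * t * (z \<bullet> z) + t\<^sup>2 * (?q z - c * (z \<bullet> z)) \<le> 0" for t
  proof -
    have "x + t *\<^sub>R z \<in> V" using xV zV V by (simp add: subspace_add subspace_scale)
    note le[OF this]
    moreover have "?q (x + t *\<^sub>R z) = ?q x + t * (x \<bullet> (A *v z) + z \<bullet> (A *v x)) + t\<^sup>2 * ?q z"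
      by (simp add: matrix_vector_right_distrib matrix_vector_mult_scaleR inner_add_left
          inner_add_right power2_eq_square algebra_simps)
    moreover have "(x + t *\<^sub>R z) \<bullet> (x + t *\<^sub>R z) = x \<bullet> x + 2 * t * (x \<bullet> z) + t\<^sup>2 * (z \<bullet> z)"
      by (simp add: inner_add_left inner_add_right power2_eq_square inner_commute algebra_simps)
    moreover have "x \<bullet> (A *v z) = z \<bullet> (A *v x)"
      using dot_matrix_symmetric[OF sym, of x z] by (simp add: inner_commute)
    moreover have "z \<bullet> (A *v x) = z \<bullet> z"
      using orth by (simp add: z_def inner_diff_right inner_commute)
    moreover have "z \<bullet> x = 0" using orth by (simp add: inner_commute)
    ultimately show ?thesis using orth nx by (simp add: c_def power2_eq_square algebra_simps)
  qed
  have "z \<bullet> z = 0"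
  proof (rule ccontr)
    assume "z \<bullet> z \<noteq> 0"
    then have p: "0 < z \<bullet> z" using inner_gt_zero_iff inner_eq_zero_iff by blast
    define a where "a = z \<bullet> z"
    define b where "b = \<bar>?q z - c * a\<bar> + 1"
    have ab: "0 < a" "0 < b" using p by (auto simp: a_def b_def)
    (* The step a / b is short enough for the linear term to dominate the quadratic one. *)
    have "2 * (a/b) * a + (a/b)\<^sup>2 * (?q z - c * a) \<le> 0" using bound[of "a/b"] by (simp add: a_def)
    moreover have "- b \<le> ?q z - c * a" by (simp add: b_def)
    then have "- ((a/b)\<^sup>2 * b) \<le> (a/b)\<^sup>2 * (?q z - c * a)"
      using mult_left_mono[of "-b" "?q z - c * a" "(a/b)\<^sup>2"] zero_le_power2[of "a/b"]
      by (metis mult_minus_right)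
    ultimately have "2 * (a/b) * a \<le> (a/b)\<^sup>2 * b" by linarith
    then have "2 * (a * a / b) \<le> a * a / b" using ab by (simp add: power2_eq_square)
    then show False using ab by (smt (verit) divide_pos_pos mult_pos_pos)
  qed
  then have "A *v x = c *\<^sub>R x" by (simp add: z_def)
  then show ?thesis using xV x by auto
qed

text \<open>The orthogonal complement of a largest orthonormal set of eigenvectors is invariant, and it
  contains no eigenvector by maximality, so it is trivial.\<close>

lemma symmetric_orthonormal_eigenbasis:
  fixes A :: "real ^ 'n ^ 'n"
  assumes sym: "transpose A = A"
  shows "\<exists>e :: 'n \<Rightarrow> real ^ 'n. \<exists>c. (\<forall>i j. e i \<bullet> e j = (if i = j then 1 else 0)) \<and>
     (\<forall>i. A *v e i = c i *\<^sub>R e i)"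
proof -
  let ?good = "\<lambda>E. pairwise orthogonal E \<and> (\<forall>x\<in>E. norm x = 1 \<and> (\<exists>c. A *v x = c *\<^sub>R x))"
  have ind: "independent E" if "?good E" for E
  proof (rule pairwise_orthogonal_independent)
    show "0 \<notin> E" using that by (metis norm_zero zero_neq_one)
  qed (use that in blast)
  have bd: "finite E \<and> card E \<le> CARD('n)" if "?good E" for E :: "(real ^ 'n) set"
    using independent_bound[OF ind[OF that]] by simp
  have "?good {}" by (simp add: pairwise_def)
  then have "\<exists>E. ?good E \<and> (\<forall>E'. ?good E' \<longrightarrow> card E' \<le> card E)"
    by (rule ex_has_greatest_nat[of ?good "{}" card "Suc CARD('n)"])
      (use bd le_imp_less_Suc in blast)
  then obtain E where E: "?good E" and max: "\<And>E'. ?good E' \<Longrightarrow> card E' \<le> card E" by blast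
  let ?V = "orthogonal_comp E"
  have V: "?V = {x. \<forall>y\<in>E. orthogonal x y}" by (auto simp: orthogonal_comp_def orthogonal_commute)
  have sV: "subspace ?V" by (rule subspace_orthogonal_comp)
  have "?V = {0}"
  proof (rule ccontr)
    assume ne: "?V \<noteq> {0}"
    have "A *v x \<in> ?V" if "x \<in> ?V" for x
    proof -
      have "orthogonal (A *v x) y" if y: "y \<in> E" for y
      proof -
        obtain c where "A *v y = c *\<^sub>R y" using E y by blast
        then show ?thesis using dot_matrix_symmetric[OF sym, of x y] \<open>x \<in> ?V\<close> y
          by (simp add: V orthogonal_def)
      qed
      then show ?thesis by (simp add: V)
    qed
    from symmetric_eigenvector_in_invariant_subspace[OF sym sV this ne]
    obtain x where x: "x \<in> ?V" "norm x = 1" "\<exists>c. A *v x = c *\<^sub>R x" by blast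
    have "x \<notin> E" using x by (auto simp: V orthogonal_def)
    moreover have "?good (insert x E)"
      using E x by (auto simp: V pairwise_insert orthogonal_commute)
    ultimately show False using max[of "insert x E"] bd[OF E] by auto
  qed
  have "span E = UNIV"
  proof -
    have "x \<in> span E" for x
    proof -
      obtain y z where yz: "y \<in> span E" "\<And>w. w \<in> span E \<Longrightarrow> orthogonal z w" "x = y + z"
        using orthogonal_subspace_decomp_exists[of E x] by blast
      then have "z \<in> ?V" by (auto simp: V span_base)
      then show ?thesis using yz \<open>?V = {0}\<close> by simp
    qed
    then show ?thesis by auto
  qed
  then have cE: "card E = CARD('n)"
    using dim_eq_card_independent[OF ind[OF E]] dim_span[of E] by simp
  then obtain e :: "'n \<Rightarrow> real ^ 'n" where e: "bij_betw e UNIV E"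
    using finite_same_card_bij[of "UNIV :: 'n set" E] bd[OF E] by auto
  have "e i \<bullet> e j = (if i = j then 1 else 0)" for i j
  proof (cases "i = j")
    case True
    have "e i \<in> E" using e by (auto simp: bij_betw_def)
    then show ?thesis using E True by (simp flip: power2_norm_eq_inner)
  next
    case False
    then have "e i \<noteq> e j" "e i \<in> E" "e j \<in> E" using e by (auto simp: bij_betw_def inj_def)
    then show ?thesis using E False by (auto simp: pairwise_def orthogonal_def)
  qed
  moreover have "\<forall>i. \<exists>c. A *v e i = c *\<^sub>R e i"
    using E e by (auto simp: bij_betw_def)
  then obtain c where "\<forall>i. A *v e i = c i *\<^sub>R e i" by metis
  ultimately show ?thesis by blast
qed

definition diag :: "real ^ 'n \<Rightarrow> real ^ 'n ^ 'n" where
  "diag l = (\<chi> i j. if i = j then l $ i else 0)"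

lemma matrix_entry_dot: "(transpose B ** A ** B) $ i $ j = column i B \<bullet> (A *v column j B)"
  for A B :: "real ^ 'n ^ 'n"
proof -
  have "(transpose B ** A ** B) $ i $ j = (transpose B ** (A ** B)) $ i $ j" by (simp add: matrix_mul_assoc)
  also have "\<dots> = row i (transpose B) \<bullet> column j (A ** B)"
    by (simp add: matrix_matrix_mult_def row_def column_def inner_vec_def)
  also have "column j (A ** B) = A *v column j B"
    by (simp add: vec_eq_iff column_def matrix_matrix_mult_def matrix_vector_mult_def)
  finally show ?thesis by (simp add: row_transpose)
qed

lemma symmetric_diagonalization:
  fixes A :: "real ^ 'n ^ 'n"
  assumes "transpose A = A"
  shows "\<exists>(Q :: real ^ 'n ^ 'n) l. transpose Q ** Q = mat 1 \<and> transpose Q ** A ** Q = diag l"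
proof -
  obtain e :: "'n \<Rightarrow> real ^ 'n" and c :: "'n \<Rightarrow> real"
    where e: "\<And>i j. e i \<bullet> e j = (if i = j then 1 else 0)"
    and c: "\<And>i. A *v e i = c i *\<^sub>R e i"
    using symmetric_orthonormal_eigenbasis[OF assms] by metis
  define Q :: "real ^ 'n ^ 'n" where "Q = (\<chi> i j. e j $ i)"
  have col: "column i Q = e i" for i by (simp add: Q_def column_def vec_eq_iff)
  have "transpose Q ** mat 1 ** Q = (mat 1 :: real ^ 'n ^ 'n)"
    unfolding vec_eq_iff matrix_entry_dot col matrix_vector_mul_lid e by (simp add: mat_def)
  moreover have "transpose Q ** A ** Q = diag (\<chi> i. c i)"
    by (simp add: vec_eq_iff matrix_entry_dot col e c diag_def)
  ultimately show ?thesis by (metis matrix_mul_rid)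
qed

section \<open>Determinants of rank-one perturbations\<close>

definition outer :: "real ^ 'n \<Rightarrow> real ^ 'n \<Rightarrow> real ^ 'n ^ 'n" where
  "outer a b = (\<chi> i j. a $ i * b $ j)"

lemma matrix_mult_distrib_right: "(A + B) ** C = A ** C + B ** C" for A B C :: "real ^ 'n ^ 'n"
  by (simp add: vec_eq_iff matrix_matrix_mult_def sum.distrib distrib_right)

lemma matrix_outer_mult: "A ** outer a b ** transpose B = outer (A *v a) (B *v b)"
  for A B :: "real ^ 'n ^ 'n"
  by (simp add: vec_eq_iff outer_def matrix_matrix_mult_def matrix_vector_mult_def transpose_def
      sum_distrib_left sum_distrib_right mult_ac)

text \<open>The matrix determinant lemma. After a rotation taking \<open>a\<close> to a multiple of a coordinate vector, the
  matrix differs from the identity in a single row.\<close>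

lemma det_mat_1_plus_outer:
  fixes a b :: "real ^ 'n"
  shows "det (mat 1 + outer a b) = 1 + a \<bullet> b"
proof (cases "a = 0")
  case True
  then have "outer a b = 0" by (simp add: outer_def vec_eq_iff)
  then show ?thesis using True by simp
next
  case False
  fix k :: 'n
  define n where "n = norm a"
  have "norm (a /\<^sub>R n) = 1" using False by (simp add: n_def)
  from orthogonal_matrix_exists_basis[OF this, of k]
  obtain Q where Q: "orthogonal_matrix Q" "Q *v axis k 1 = a /\<^sub>R n" by metis
  define R where "R = transpose Q"
  have RQ: "R ** Q = mat 1" "R ** transpose R = mat 1"
    using Q(1) by (auto simp: orthogonal_matrix_def R_def)
  have "R *v a = n *\<^sub>R (R *v (a /\<^sub>R n))"
    using False by (simp add: n_def matrix_vector_mult_scaleR)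
  also have "\<dots> = n *\<^sub>R axis k 1"
    by (simp add: matrix_vector_mul_assoc RQ flip: Q(2))
  finally have Ra: "R *v a = n *\<^sub>R axis k 1" .
  define c where "c = R *v b"
  have "R ** (mat 1 + outer a b) ** transpose R = mat 1 + outer (n *\<^sub>R axis k 1) c"
    by (simp add: matrix_add_ldistrib matrix_mult_distrib_right RQ matrix_outer_mult Ra c_def)
  then have "det R * det (transpose R) * det (mat 1 + outer a b) = det (mat 1 + outer (n *\<^sub>R axis k 1) c)"
    by (metis det_mul mult.commute mult.left_commute)
  moreover have "det R * det (transpose R) = 1"
    by (metis RQ(2) det_I det_mul)
  moreover have "det (mat 1 + outer (n *\<^sub>R axis k 1) c) = 1 + n * c $ k"
  proof -
    define x where "x = axis k 1 + n *\<^sub>R c"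
    have rows: "row i (mat 1) = axis i (1::real)" for i :: 'n
      by (simp add: row_def mat_def axis_def vec_eq_iff)
    have "(\<Sum>i\<in>UNIV. x $ i *s axis i 1) = x" by (rule basis_expansion)
    then have "mat 1 + outer (n *\<^sub>R axis k 1) c =
      (\<chi> i. if i = k then sum (\<lambda>i. x $ i *s row i (mat 1)) UNIV else row i (mat 1))"
      unfolding rows by (auto simp: vec_eq_iff x_def outer_def mat_def axis_def)
    then have "det (mat 1 + outer (n *\<^sub>R axis k 1) c) = x $ k * det (mat 1 :: real ^ 'n ^ 'n)"
      by (simp only: cramer_lemma_transpose)
    then show ?thesis by (simp add: x_def)
  qed
  moreover have "n * c $ k = a \<bullet> b"
  proof -
    have "n * c $ k = (R *v a) \<bullet> (R *v b)" by (simp add: Ra c_def inner_axis')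
    also have "\<dots> = a \<bullet> (transpose R *v (R *v b))"
      by (metis dot_lmul_matrix inner_commute vector_transpose_matrix transpose_transpose)
    also have "\<dots> = a \<bullet> b"
      using RQ by (metis matrix_left_right_inverse matrix_vector_mul_assoc matrix_vector_mul_lid)
    finally show ?thesis .
  qed
  ultimately show ?thesis by simp
qed

lemma diag_mult_entry: "(diag d ** A) $ i $ j = d $ i * A $ i $ j"
proof -
  have "(diag d ** A) $ i $ j = (\<Sum>k\<in>UNIV. if k = i then d $ k * A $ k $ j else 0)"
    unfolding matrix_matrix_mult_def diag_def vec_lambda_beta by (intro sum.cong) auto
  then show ?thesis by simp
qed

lemma det_diag: "det (diag d) = (\<Prod>i\<in>UNIV. d $ i)"
  by (subst det_diagonal) (auto simp: diag_def)

lemma det_diag_plus_outer: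
  fixes d w :: "real ^ 'n"
  assumes nz: "\<And>i. d $ i \<noteq> 0"
  shows "det (diag d + s *\<^sub>R outer w w)
    = (\<Prod>i\<in>UNIV. d $ i) + s * (\<Sum>i\<in>UNIV. (w $ i)\<^sup>2 * (\<Prod>l\<in>UNIV - {i}. d $ l))"
proof -
  define a where "a = (\<chi> i. s * w $ i / d $ i)"
  have "diag d + s *\<^sub>R outer w w = diag d ** (mat 1 + outer a w)"
    using nz by (simp add: vec_eq_iff diag_mult_entry)
      (simp add: diag_def outer_def a_def mat_def distrib_left)
  then have "det (diag d + s *\<^sub>R outer w w) = (\<Prod>i\<in>UNIV. d $ i) * (1 + a \<bullet> w)"
    by (simp add: det_mul det_diag det_mat_1_plus_outer)
  also have "\<dots> = (\<Prod>i\<in>UNIV. d $ i) + (\<Sum>i\<in>UNIV. (\<Prod>i\<in>UNIV. d $ i) * (a $ i * w $ i))"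
    by (simp add: distrib_left inner_vec_def sum_distrib_left)
  also have "(\<Sum>i\<in>UNIV. (\<Prod>i\<in>UNIV. d $ i) * (a $ i * w $ i))
      = (\<Sum>i\<in>UNIV. s * ((w $ i)\<^sup>2 * (\<Prod>l\<in>UNIV - {i}. d $ l)))"
  proof (rule sum.cong[OF refl])
    fix i :: 'n
    have "(\<Prod>i\<in>UNIV. d $ i) = d $ i * (\<Prod>l\<in>UNIV - {i}. d $ l)"
      by (rule prod.remove) auto
    then show "(\<Prod>i\<in>UNIV. d $ i) * (a $ i * w $ i) = s * ((w $ i)\<^sup>2 * (\<Prod>l\<in>UNIV - {i}. d $ l))"
      using nz[of i] by (simp add: a_def power2_eq_square)
  qed
  finally show ?thesis by (simp add: sum_distrib_left)
qed

section \<open>Elementary symmetric functions as coefficients\<close>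

text \<open>The generating polynomial. It turns statements about determinants \<open>det (1 + x M)\<close> into statements
  about the elementary symmetric functions of the eigenvalues of \<open>M\<close>.\<close>

definition esym_poly :: "'i set \<Rightarrow> ('i \<Rightarrow> real) \<Rightarrow> real poly" where
  "esym_poly F l = (\<Prod>i\<in>F. [:1, l i:])"

lemma coeff_esym_poly: "finite F \<Longrightarrow> coeff (esym_poly F l) m = esym F m l"
proof (induction F arbitrary: m rule: finite_induct)
  case empty
  then show ?case by (cases m) (auto simp: esym_poly_def esym_eq_0)
next
  case (insert a F)
  then show ?case
    by (cases m) (auto simp: esym_poly_def esym_insert algebra_simps coeff_pCons)
qed

lemma poly_esym_poly: "poly (esym_poly F l) x = (\<Prod>i\<in>F. 1 + x * l i)"
  by (simp add: esym_poly_def poly_prod)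

lemma degree_esym_poly: "finite F \<Longrightarrow> degree (esym_poly F l) \<le> card F"
  by (rule degree_le) (simp add: coeff_esym_poly esym_eq_0)

lemma poly_eq_near_0:
  fixes p q :: "real poly"
  assumes "e > 0" "\<And>x. \<bar>x\<bar> < e \<Longrightarrow> poly p x = poly q x"
  shows "p = q"
proof (rule ccontr)
  assume "p \<noteq> q"
  then have "finite {x. poly (p - q) x = 0}" by (intro poly_roots_finite) simp
  moreover have "{0<..<e} \<subseteq> {x. poly (p - q) x = 0}" using assms by auto
  ultimately show False using infinite_Ioo[OF assms(1)] finite_subset by blast
qed

text \<open>Induction on the degree: dividing \<open>F p - F p (a)\<close> by \<open>X - a\<close> lowers the degree and keeps the
  values continuous, except at \<open>a\<close>, where they are not defined by the quotient. For this reason the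
  induction runs over infinite sets \<open>T\<close> of evaluation points, from which one point is removed in each
  step.\<close>

lemma continuous_on_coeff:
  fixes F :: "'b::topological_space \<Rightarrow> real poly"
  assumes "\<And>p. p \<in> X \<Longrightarrow> degree (F p) \<le> n" "\<And>x. continuous_on X (\<lambda>p. poly (F p) x)"
  shows "continuous_on X (\<lambda>p. coeff (F p) j)"
proof -
  have "continuous_on X (\<lambda>p. coeff (F p) j)" if "infinite T"
      "\<And>p. p \<in> X \<Longrightarrow> degree (F p) \<le> n" "\<And>x. x \<in> T \<Longrightarrow> continuous_on X (\<lambda>p. poly (F p) x)"
    for T :: "real set" and F n j
    using that
  proof (induction n arbitrary: F T j)
    case 0
    obtain x where x: "x \<in> T" using 0 by (metis finite.emptyI ex_in_conv)
    show ?case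
    proof (cases j)
      case j0: 0
      have "coeff (F p) j = poly (F p) x" if "p \<in> X" for p
        using 0(2)[OF that] by (auto simp: j0 elim: degree_eq_zeroE)
      then show ?thesis using 0(3)[OF x] by (simp cong: continuous_on_cong)
    next
      case (Suc j')
      then have "coeff (F p) j = 0" if "p \<in> X" for p
        using 0(2)[OF that] by (simp add: coeff_eq_0)
      then show ?thesis by (simp cong: continuous_on_cong)
    qed
  next
    case (Suc n)
    obtain a where a: "a \<in> T" using Suc by (metis finite.emptyI ex_in_conv)
    define G where "G = (\<lambda>p. synthetic_div (F p) a)"
    have FG: "F p = [:-a, 1:] * G p + [:poly (F p) a:]" for p
      using synthetic_div_correct'[of a "F p"] by (simp add: G_def)
    have E: "poly (F p) x = (x - a) * poly (G p) x + poly (F p) a" for p x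
      by (subst FG) (simp add: algebra_simps)
    have G: "poly (G p) x = (poly (F p) x - poly (F p) a) / (x - a)" if "x \<noteq> a" for p x
      using that E[of p x] by simp
    have cG: "continuous_on X (\<lambda>p. coeff (G p) j)" for j
    proof (rule Suc.IH)
      show "infinite (T - {a})" using Suc by simp
      show "degree (G p) \<le> n" if "p \<in> X" for p
        using Suc.prems(2)[OF that] by (simp add: G_def degree_synthetic_div)
      show "continuous_on X (\<lambda>p. poly (G p) x)" if "x \<in> T - {a}" for x
        using that a Suc.prems(3) by (auto simp: G intro!: continuous_intros)
    qed
    have "coeff (F p) j = (case j of 0 \<Rightarrow> poly (F p) a - a * coeff (G p) 0
        | Suc j' \<Rightarrow> coeff (G p) j' - a * coeff (G p) j)" for p
      by (subst FG) (auto split: nat.split simp: coeff_pCons)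
    then show ?case
      using cG a Suc.prems(3)[of a] by (cases j) (auto intro!: continuous_intros)
  qed
  from this[of UNIV F n j] show ?thesis using assms infinite_UNIV_char_0 by blast
qed

section \<open>Eigenvalues relative to a metric\<close>

definition pos_def :: "real ^ 'n ^ 'n \<Rightarrow> bool" where
  "pos_def g \<longleftrightarrow> transpose g = g \<and> (\<forall>v. v \<noteq> 0 \<longrightarrow> 0 < v \<bullet> (g *v v))"

lemma matrix_inv_unique:
  fixes A B :: "real ^ 'n ^ 'n"
  assumes "A ** B = mat 1"
  shows "matrix_inv A = B"
proof -
  have "\<exists>B. A ** B = mat 1 \<and> B ** A = mat 1" using assms matrix_left_right_inverse by blast
  from someI_ex[OF this] have "matrix_inv A ** A = mat 1" by (simp add: matrix_inv_def)
  then show ?thesis using assms by (metis matrix_mul_assoc matrix_mul_lid matrix_mul_rid)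
qed

lemma diag_mult_diag: "diag a ** diag b = diag (\<chi> i. a $ i * b $ i)"
  by (simp add: vec_eq_iff diag_mult_entry) (simp add: diag_def)

lemma transpose_diag [simp]: "transpose (diag a) = diag a"
  by (auto simp: diag_def transpose_def vec_eq_iff)

text \<open>First \<open>g\<close> is made the identity by diagonalizing and rescaling; a rotation then diagonalizes the
  transformed \<open>A\<close> without disturbing the identity.\<close>

lemma simultaneous_diagonalization:
  fixes g A :: "real ^ 'n ^ 'n"
  assumes g: "pos_def g" and A: "transpose A = A"
  obtains B :: "real ^ 'n ^ 'n" and l where "transpose B ** g ** B = mat 1" "transpose B ** A ** B = diag l"
    "matrix_inv g = B ** transpose B"
proof -
  obtain Q d where Q: "transpose Q ** Q = mat 1" "transpose Q ** g ** Q = diag (d :: real ^ 'n)"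
    using symmetric_diagonalization[of g] g unfolding pos_def_def by blast
  have d: "0 < d $ i" for i
  proof -
    have "column i Q \<bullet> column i Q = (transpose Q ** mat 1 ** Q) $ i $ i"
      by (simp only: matrix_entry_dot matrix_vector_mul_lid)
    moreover have "(transpose Q ** mat 1 ** Q) $ i $ i = 1" by (simp add: Q(1)) (simp add: mat_def)
    ultimately have "column i Q \<noteq> 0" by auto
    moreover have "d $ i = column i Q \<bullet> (g *v column i Q)"
      using arg_cong[OF Q(2), of "\<lambda>M. M $ i $ i"] by (simp add: matrix_entry_dot diag_def)
    ultimately show ?thesis using g by (simp add: pos_def_def)
  qed
  define R where "R = Q ** diag (\<chi> i. 1 / sqrt (d $ i))"
  have "transpose R ** g ** R = diag (\<chi> i. 1 / sqrt (d $ i)) ** (transpose Q ** g ** Q) ** diag (\<chi> i. 1 / sqrt (d $ i))"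
    by (simp add: R_def matrix_transpose_mul matrix_mul_assoc)
  also have "\<dots> = diag (\<chi> i. 1)"
  proof -
    have "1 / sqrt (d $ i) * d $ i * (1 / sqrt (d $ i)) = 1" for i
      using d[of i] real_sqrt_mult_self[of "d $ i"] by (simp add: field_simps)
    then show ?thesis by (simp add: Q diag_mult_diag)
  qed
  also have "\<dots> = mat 1" by (auto simp: diag_def mat_def vec_eq_iff)
  finally have R: "transpose R ** g ** R = mat 1" .
  define A' where "A' = transpose R ** A ** R"
  have "transpose A' = A'" by (simp add: A'_def matrix_transpose_mul A matrix_mul_assoc)
  then obtain U l where U: "transpose U ** U = mat 1" "transpose U ** A' ** U = diag (l :: real ^ 'n)"
    using symmetric_diagonalization by blast
  define B where "B = R ** U"
  have "transpose B ** g ** B = transpose U ** (transpose R ** g ** R) ** U"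
    by (simp add: B_def matrix_transpose_mul matrix_mul_assoc)
  then have 1: "transpose B ** g ** B = mat 1" by (simp add: R U)
  have 2: "transpose B ** A ** B = diag l"
    using U(2) by (simp add: A'_def B_def matrix_transpose_mul matrix_mul_assoc)
  have "(g ** B) ** transpose B = mat 1"
    using 1 matrix_left_right_inverse[of "transpose B" "g ** B"] by (simp add: matrix_mul_assoc)
  then have "matrix_inv g = B ** transpose B"
    by (intro matrix_inv_unique) (simp add: matrix_mul_assoc)
  with 1 2 show thesis by (rule that)
qed

lemma mat_commute: "mat t ** A = A ** mat t" for A :: "real ^ 'n ^ 'n"
  by (simp add: vec_eq_iff matrix_matrix_mult_def mat_def if_distrib[of "\<lambda>x. x * _"]
      if_distrib[of "\<lambda>x. _ * x"] cong: if_cong)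

lemma matrix_diff_distrib:
  fixes A B C :: "real ^ 'n ^ 'n"
  shows "(A - B) ** C = A ** C - B ** C" "C ** (A - B) = C ** A - C ** B"
  by (simp_all add: vec_eq_iff matrix_matrix_mult_def sum_subtractf algebra_simps)

lemma det_char_similar:
  fixes M N X :: "real ^ 'n ^ 'n"
  assumes "M ** X = X ** N" "det X \<noteq> 0"
  shows "det (mat t - M) = det (mat t - N)"
proof -
  have "(mat t - M) ** X = X ** (mat t - N)"
    by (simp add: matrix_diff_distrib assms mat_commute)
  then have "det (mat t - M) * det X = det X * det (mat t - N)" by (metis det_mul)
  then show ?thesis using assms by simp
qed

text \<open>The listings are equal, and not only permutations of each other, because the choice depends on the
  matrix through its characteristic polynomial alone.\<close>

lemma eigenvalues_of_similar:
  fixes M N X :: "real ^ 'n ^ 'n"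
  assumes "M ** X = X ** N" "det X \<noteq> 0"
  shows "eigenvalues_of M = eigenvalues_of N"
  by (simp add: eigenvalues_of_def det_char_similar[OF assms])

lemma det_1_plus_scaled:
  fixes M :: "real ^ 'n ^ 'n" and l :: "real ^ 'n"
  assumes "\<And>t. det (mat t - M) = (\<Prod>i\<in>UNIV. t - l $ i)"
  shows "det (mat 1 + x *\<^sub>R M) = (\<Prod>i\<in>UNIV. 1 + x * l $ i)"
proof (cases "x = 0")
  case False
  have "mat 1 + x *\<^sub>R M = diag (\<chi> i. -x) ** (mat (-1/x) - M)"
    using False by (simp add: vec_eq_iff diag_mult_entry) (auto simp: mat_def algebra_simps)
  then have "det (mat 1 + x *\<^sub>R M) = (\<Prod>i\<in>(UNIV :: 'n set). -x) * (\<Prod>i\<in>UNIV. -1/x - l $ i)"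
    by (simp only: det_mul det_diag assms vec_lambda_beta)
  also have "\<dots> = (\<Prod>i\<in>UNIV. (-x) * (-1/x - l $ i))" by (simp only: prod.distrib)
  also have "\<dots> = (\<Prod>i\<in>UNIV. 1 + x * l $ i)"
    using False by (intro prod.cong) (auto simp: field_simps)
  finally show ?thesis .
qed simp

definition sym_eig :: "nat \<Rightarrow> real ^ 'n ^ 'n \<Rightarrow> real ^ 'n ^ 'n \<Rightarrow> real" where
  "sym_eig j g A = esym UNIV j (($) (eigenvalues_of (matrix_inv g ** A)))"

text \<open>The matrix \<open>g\<^sup>-\<^sup>1 A\<close> is similar to a real diagonal one, so its characteristic polynomial splits
  and the choice in \<^const>\<open>eigenvalues_of\<close> has a witness.\<close>

lemma eigenvalues_of_pencil:
  fixes g A :: "real ^ 'n ^ 'n"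
  assumes g: "pos_def g" and A: "transpose A = A"
  shows "det (mat t - matrix_inv g ** A) = (\<Prod>i\<in>UNIV. t - eigenvalues_of (matrix_inv g ** A) $ i)"
proof -
  obtain B :: "real ^ 'n ^ 'n" and l :: "real ^ 'n"
    where B: "transpose B ** g ** B = mat 1" "transpose B ** A ** B = diag l"
    "matrix_inv g = B ** transpose B"
    by (rule simultaneous_diagonalization[OF assms])
  have "det B \<noteq> 0" using B(1) by (metis det_I det_mul mult_zero_right zero_neq_one)
  moreover have "(matrix_inv g ** A) ** B = B ** diag l"
    by (simp add: B(3) matrix_mul_assoc flip: B(2))
  ultimately have "det (mat t - matrix_inv g ** A) = det (mat t - diag l)" for t
    by (intro det_char_similar)
  also have "det (mat t - diag l) = (\<Prod>i\<in>UNIV. t - l $ i)" for t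
  proof -
    have "mat t - diag l = diag (\<chi> i. t - l $ i)" by (auto simp: vec_eq_iff diag_def mat_def)
    then show ?thesis by (simp add: det_diag)
  qed
  finally have "\<exists>l :: real ^ 'n. \<forall>t. det (mat t - matrix_inv g ** A) = (\<Prod>i\<in>UNIV. t - l $ i)" by blast
  from someI_ex[OF this] show ?thesis unfolding eigenvalues_of_def by blast
qed

lemma poly_sym_eig:
  fixes g A :: "real ^ 'n ^ 'n"
  assumes "pos_def g" "transpose A = A"
  shows "poly (esym_poly UNIV (($) (eigenvalues_of (matrix_inv g ** A)))) x
    = det (mat 1 + x *\<^sub>R (matrix_inv g ** A))"
  by (simp add: poly_esym_poly det_1_plus_scaled[OF eigenvalues_of_pencil[OF assms]])

text \<open>Polynomials that agree near \<open>0\<close> are equal. The freedom to take \<open>x\<close> small serves to keep diagonal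
  entries of the form \<open>1 + x l\<^sub>i\<close> away from zero.\<close>

lemma sym_eig_eqI:
  fixes g A :: "real ^ 'n ^ 'n"
  assumes "pos_def g" "transpose A = A" "e > 0"
    and "\<And>x. \<bar>x\<bar> < e \<Longrightarrow> det (mat 1 + x *\<^sub>R (matrix_inv g ** A)) = poly p x"
  shows "sym_eig j g A = coeff p j"
proof -
  have "esym_poly UNIV (($) (eigenvalues_of (matrix_inv g ** A))) = p"
    by (rule poly_eq_near_0[OF \<open>e > 0\<close>]) (simp add: poly_sym_eig[OF assms(1,2)] assms(4))
  then show ?thesis by (simp add: sym_eig_def flip: coeff_esym_poly)
qed

lemma matrix_scaleR_mult:
  fixes A B :: "real ^ 'n ^ 'n"
  shows "(c *\<^sub>R A) ** B = c *\<^sub>R (A ** B)" "A ** (c *\<^sub>R B) = c *\<^sub>R (A ** B)"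
  by (simp_all add: vec_eq_iff matrix_matrix_mult_def sum_distrib_left mult_ac)

text \<open>In a basis that diagonalizes \<open>A\<close>, the determinant of \<open>1 + x (A + s v v\<^sup>T)\<close> is affine in \<open>s\<close> with
  slope \<open>x \<Sum>\<^sub>i w\<^sub>i\<^sup>2 \<Prod>\<^sub>m\<^sub>\<noteq>\<^sub>i (1 + x l\<^sub>m)\<close>. The eigenvalues are returned as
  some listing \<open>l\<close>, since the weights \<open>w\<^sub>i\<close> refer to the order of the chosen basis.\<close>

lemma sym_eig_rank_one:
  fixes g A :: "real ^ 'n ^ 'n"
  assumes g: "pos_def g" and A: "transpose A = A"
  obtains l :: "real ^ 'n" and w where "\<And>j. esym UNIV j (($) l) = sym_eig j g A"
    "\<And>s j. sym_eig (Suc j) g (A + s *\<^sub>R outer v v)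
        = sym_eig (Suc j) g A + s * (\<Sum>i\<in>UNIV. (w i)\<^sup>2 * esym (UNIV - {i}) j (($) l))"
proof -
  obtain B :: "real ^ 'n ^ 'n" and l :: "real ^ 'n"
    where B: "transpose B ** g ** B = mat 1" "transpose B ** A ** B = diag l"
    "matrix_inv g = B ** transpose B"
    by (rule simultaneous_diagonalization[OF assms])
  have dB: "det B \<noteq> 0" using B(1) by (metis det_I det_mul mult_zero_right zero_neq_one)
  define w where "w = transpose B *v v"
  define p where "p = (\<lambda>s. esym_poly UNIV (($) l)
    + [:0, s:] * (\<Sum>i\<in>UNIV. smult ((w $ i)\<^sup>2) (esym_poly (UNIV - {i}) (($) l))))"
  (* For x below this bound every 1 + x * l $ i is nonzero. *)
  define e where "e = 1 / (norm l + 1)"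
  have "0 < norm l + 1" using norm_ge_zero[of l] by linarith
  then have e: "e > 0" by (simp add: e_def)
  have nz: "1 + x * l $ i \<noteq> 0" if "\<bar>x\<bar> < e" for x i
  proof -
    have "\<bar>x * l $ i\<bar> \<le> \<bar>x\<bar> * norm l"
      by (simp add: abs_mult component_le_norm_cart mult_left_mono)
    also have "\<dots> \<le> \<bar>x\<bar> * (norm l + 1)" by (simp add: distrib_left)
    also have "\<dots> < 1" using that \<open>0 < norm l + 1\<close> by (simp add: e_def pos_less_divide_eq)
    finally show ?thesis by linarith
  qed
  have sym: "transpose (A + s *\<^sub>R outer v v) = A + s *\<^sub>R outer v v" for s
    using A by (simp add: vec_eq_iff transpose_def outer_def mult.commute)
  have main: "sym_eig j g (A + s *\<^sub>R outer v v) = coeff (p s) j" for j s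
  proof (rule sym_eig_eqI[OF g sym e])
    fix x :: real assume x: "\<bar>x\<bar> < e"
    let ?M = "matrix_inv g ** (A + s *\<^sub>R outer v v)"
    have D: "transpose B ** (A + s *\<^sub>R outer v v) ** B = diag l + s *\<^sub>R outer w w"
      using matrix_outer_mult[of "transpose B" v v "transpose B"]
      by (simp add: matrix_add_ldistrib matrix_mult_distrib_right matrix_scaleR_mult B w_def)
    have "?M ** B = B ** (diag l + s *\<^sub>R outer w w)"
      unfolding D[symmetric] by (simp add: B(3) matrix_mul_assoc)
    then have "(mat 1 + x *\<^sub>R ?M) ** B = B ** (mat 1 + x *\<^sub>R (diag l + s *\<^sub>R outer w w))"
      by (simp add: matrix_add_ldistrib matrix_mult_distrib_right matrix_scaleR_mult)
    then have "det (mat 1 + x *\<^sub>R ?M) = det (mat 1 + x *\<^sub>R (diag l + s *\<^sub>R outer w w))"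
      using dB by (metis det_mul mult.commute mult_cancel_left)
    also have "mat 1 + x *\<^sub>R (diag l + s *\<^sub>R outer w w) = diag (\<chi> i. 1 + x * l $ i) + (x * s) *\<^sub>R outer w w"
      by (auto simp: vec_eq_iff diag_def mat_def algebra_simps)
    also have "det \<dots> = poly (p s) x"
      using nz[OF x] by (subst det_diag_plus_outer) (auto simp: p_def poly_esym_poly poly_sum)
    finally show "det (mat 1 + x *\<^sub>R ?M) = poly (p s) x" .
  qed
  have base: "sym_eig j g A = esym UNIV j (($) l)" for j
    using main[of j 0] by (simp add: p_def coeff_esym_poly)
  have "coeff (p s) (Suc j) = esym UNIV (Suc j) (($) l)
      + s * (\<Sum>i\<in>UNIV. (w $ i)\<^sup>2 * esym (UNIV - {i}) j (($) l))" for s j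
    by (simp add: p_def coeff_esym_poly coeff_pCons coeff_sum)
  then show thesis using main base by (intro that[of l "($) w"]) simp_all
qed

section \<open>Monotonicity on the cone\<close>

text \<open>Membership of the eigenvalues in \<open>\<Gamma>\<^sub>k\<^sup>+\<close> in terms of quantities that are continuous in \<open>A\<close> and do
  not depend on the order of the eigenvalues.\<close>

definition admissible :: "nat \<Rightarrow> real ^ 'n ^ 'n \<Rightarrow> real ^ 'n ^ 'n \<Rightarrow> bool" where
  "admissible k g A \<longleftrightarrow> (\<forall>j\<le>k. 0 < sym_eig j g A)"

lemma eigenvalues_in_Gamma_plus_iff:
  fixes g A :: "real ^ 'n ^ 'n"
  assumes "k \<le> CARD('n)"
  shows "eigenvalues_of (matrix_inv g ** A) \<in> Gamma_plus k \<longleftrightarrow> admissible k g A"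
  unfolding admissible_def sym_eig_def
proof (intro iffI allI impI)
  assume "\<forall>j\<le>k. 0 < esym UNIV j (($) (eigenvalues_of (matrix_inv g ** A)))"
  then show "eigenvalues_of (matrix_inv g ** A) \<in> Gamma_plus k"
    by (intro Gamma_plusI[OF assms]) (simp_all add: less_imp_le)
qed (rule Gamma_plus_esym_pos[OF assms])

lemma admissibleI:
  fixes g A :: "real ^ 'n ^ 'n"
  assumes "k \<le> CARD('n)" "\<And>j. j < k \<Longrightarrow> 0 \<le> sym_eig j g A" "0 < sym_eig k g A"
  shows "admissible k g A"
  using Gamma_plusI[OF assms(1), of "eigenvalues_of (matrix_inv g ** A)"] assms
    eigenvalues_in_Gamma_plus_iff[OF assms(1), of g A] by (simp add: sym_eig_def)

text \<open>The coefficients in the rank-one formula are first derivatives of \<open>\<sigma>\<^sub>j\<close>, which are positive on the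
  cone.\<close>

lemma admissible_add_rank_one:
  fixes g A :: "real ^ 'n ^ 'n"
  assumes g: "pos_def g" and A: "transpose A = A" and k: "k \<le> CARD('n)" "admissible k g A"
    and s: "0 \<le> s" and j: "j \<le> k"
  shows "sym_eig j g A \<le> sym_eig j g (A + s *\<^sub>R outer v v)"
proof (cases j)
  case 0
  then show ?thesis by (simp add: sym_eig_def)
next
  case (Suc j')
  show ?thesis
  proof (rule sym_eig_rank_one[OF g A, of v])
    fix l :: "real ^ 'n" and w
    assume l: "\<And>j. esym UNIV j (($) l) = sym_eig j g A"
      and w: "\<And>s j. sym_eig (Suc j) g (A + s *\<^sub>R outer v v)
        = sym_eig (Suc j) g A + s * (\<Sum>i\<in>UNIV. (w i)\<^sup>2 * esym (UNIV - {i}) j (($) l))"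
    have "l \<in> Gamma_plus k"
      using k(2) by (intro Gamma_plusI[OF k(1)]) (simp_all add: l admissible_def less_imp_le)
    then have "0 \<le> (\<Sum>i\<in>UNIV. (w i)\<^sup>2 * esym (UNIV - {i}) j' (($) l))"
      using Gamma_plus_esym_remove_pos[OF k(1)] j Suc
      by (intro sum_nonneg mult_nonneg_nonneg) (auto simp: less_imp_le)
    then show "sym_eig j g A \<le> sym_eig j g (A + s *\<^sub>R outer v v)" using w s by (simp add: Suc)
  qed
qed

text \<open>Diagonalizing \<open>P\<close> orthogonally writes it as a sum of rank-one matrices with nonnegative
  coefficients, which are added one at a time.\<close>

lemma admissible_add_nonneg:
  fixes g A P :: "real ^ 'n ^ 'n"
  assumes g: "pos_def g" and A: "transpose A = A" and k: "k \<le> CARD('n)" "admissible k g A"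
    and P: "transpose P = P" "\<And>v. 0 \<le> v \<bullet> (P *v v)"
  shows "admissible k g (A + P) \<and> sym_eig k g A \<le> sym_eig k g (A + P)"
proof -
  obtain Q c where Q: "transpose Q ** Q = mat 1" "transpose Q ** P ** Q = diag (c :: real ^ 'n)"
    using symmetric_diagonalization[OF P(1)] by blast
  have c: "0 \<le> c $ i" for i
    using arg_cong[OF Q(2), of "\<lambda>M. M $ i $ i"] P(2)[of "column i Q"]
    by (simp add: matrix_entry_dot diag_def)
  have Q': "Q ** transpose Q = mat 1" using Q(1) matrix_left_right_inverse by blast
  have "Q ** diag c ** transpose Q = (Q ** transpose Q) ** P ** (Q ** transpose Q)"
    by (simp add: matrix_mul_assoc flip: Q(2))
  then have "P = Q ** diag c ** transpose Q" by (simp add: Q')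
  also have "Q ** diag c = (\<chi> i j. Q $ i $ j * c $ j)"
    by (simp add: vec_eq_iff matrix_matrix_mult_def diag_def if_distrib[of "\<lambda>x. _ * x"] cong: if_cong)
  also have "\<dots> ** transpose Q = (\<Sum>i\<in>UNIV. c $ i *\<^sub>R outer (column i Q) (column i Q))"
    by (simp add: vec_eq_iff matrix_matrix_mult_def transpose_def outer_def column_def
        sum_component mult_ac)
  finally have Psum: "P = (\<Sum>i\<in>UNIV. c $ i *\<^sub>R outer (column i Q) (column i Q))" .
  have "transpose (A + (\<Sum>i\<in>F. c $ i *\<^sub>R outer (column i Q) (column i Q)))
      = A + (\<Sum>i\<in>F. c $ i *\<^sub>R outer (column i Q) (column i Q)) \<and>
     admissible k g (A + (\<Sum>i\<in>F. c $ i *\<^sub>R outer (column i Q) (column i Q))) \<and>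
     sym_eig k g A \<le> sym_eig k g (A + (\<Sum>i\<in>F. c $ i *\<^sub>R outer (column i Q) (column i Q)))"
    if "finite F" for F
    using that
  proof (induction F rule: finite_induct)
    case empty
    then show ?case using A k by simp
  next
    case (insert a F)
    let ?A = "A + (\<Sum>i\<in>F. c $ i *\<^sub>R outer (column i Q) (column i Q))"
    let ?O = "outer (column a Q) (column a Q)"
    have eq: "A + (\<Sum>i\<in>insert a F. c $ i *\<^sub>R outer (column i Q) (column i Q)) = ?A + c $ a *\<^sub>R ?O"
      using insert.hyps by simp
    have mono: "sym_eig j g ?A \<le> sym_eig j g (?A + c $ a *\<^sub>R ?O)" if "j \<le> k" for j
      using insert.IH c that by (intro admissible_add_rank_one[OF g _ k(1)]) auto
    have "transpose (?A + c $ a *\<^sub>R ?O) = transpose ?A + c $ a *\<^sub>R ?O"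
      by (simp add: vec_eq_iff transpose_def outer_def mult.commute)
    moreover have "admissible k g (?A + c $ a *\<^sub>R ?O)"
      unfolding admissible_def using mono insert.IH by (meson admissible_def less_le_trans)
    moreover have "sym_eig k g A \<le> sym_eig k g (?A + c $ a *\<^sub>R ?O)"
      using insert.IH mono[OF order_refl] by linarith
    ultimately show ?case unfolding eq using insert.IH by simp
  qed
  then show ?thesis unfolding Psum by simp
qed

section \<open>Continuous dependence on the matrices\<close>

lemma continuous_on_det:
  fixes M :: "'b::topological_space \<Rightarrow> real ^ 'n ^ 'n"
  assumes "\<And>i j. continuous_on X (\<lambda>p. M p $ i $ j)"
  shows "continuous_on X (\<lambda>p. det (M p))"
  unfolding det_def by (intro continuous_intros assms)

lemma matrix_inv_works:
  fixes A :: "real ^ 'n ^ 'n"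
  assumes "det A \<noteq> 0"
  shows "A ** matrix_inv A = mat 1" "matrix_inv A ** A = mat 1"
proof -
  have "\<exists>B. A ** B = mat 1 \<and> B ** A = mat 1"
    using assms invertible_det_nz[of A] unfolding invertible_def by blast
  from someI_ex[OF this] show "A ** matrix_inv A = mat 1" "matrix_inv A ** A = mat 1"
    by (simp_all add: matrix_inv_def)
qed

lemma matrix_inv_entry:
  fixes A :: "real ^ 'n ^ 'n"
  assumes "det A \<noteq> 0"
  shows "matrix_inv A $ k $ l = det (\<chi> i j. if j = k then axis l 1 $ i else A $ i $ j) / det A"
proof -
  have "A *v (matrix_inv A *v axis l 1) = axis l 1"
    by (simp add: matrix_vector_mul_assoc matrix_inv_works(1)[OF assms])
  then have "matrix_inv A *v axis l 1 = (\<chi> k. det(\<chi> i j. if j=k then axis l 1 $i else A$i$j) / det A)"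
    using cramer[OF assms] by blast
  then have "(matrix_inv A *v axis l 1) $ k = det (\<chi> i j. if j = k then axis l 1 $ i else A $ i $ j) / det A"
    by simp
  moreover have "(matrix_inv A *v axis l 1) $ k = matrix_inv A $ k $ l"
    by (simp add: matrix_vector_mult_basis column_def)
  ultimately show ?thesis by simp
qed

lemma continuous_on_matrix_inv:
  fixes M :: "'b::topological_space \<Rightarrow> real ^ 'n ^ 'n"
  assumes "\<And>i j. continuous_on X (\<lambda>p. M p $ i $ j)" "\<And>p. p \<in> X \<Longrightarrow> det (M p) \<noteq> 0"
  shows "continuous_on X (\<lambda>p. matrix_inv (M p) $ k $ l)"
proof -
  have "continuous_on X (\<lambda>p. det (\<chi> i j. if j = k then axis l 1 $ i else M p $ i $ j) / det (M p))"
  proof (intro continuous_on_divide continuous_on_det assms ballI)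
    show "continuous_on X (\<lambda>p. (\<chi> i j. if j = k then axis l 1 $ i else M p $ i $ j) $ i $ j)" for i j
      using assms(1) by (cases "j = k") auto
  qed (use assms in auto)
  then show ?thesis using assms(2) by (simp add: matrix_inv_entry cong: continuous_on_cong)
qed

lemma pos_def_det: "pos_def (g :: real ^ 'a ^ 'a) \<Longrightarrow> det g \<noteq> 0"
proof -
  assume g: "pos_def g"
  have "transpose (0 :: real ^ 'a ^ 'a) = 0" by (simp add: transpose_def vec_eq_iff)
  then obtain B :: "real ^ 'a ^ 'a" where "transpose B ** g ** B = mat 1"
    using simultaneous_diagonalization[OF g] by blast
  then have "det (transpose B) * det g * det B = 1" by (metis det_I det_mul)
  then show "det g \<noteq> 0" by auto
qed

text \<open>The eigenvalues come without any continuous choice, but their generating polynomial is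
  \<open>det (1 + x g\<^sup>-\<^sup>1 A)\<close>, whose values are continuous for each \<open>x\<close>.\<close>

lemma continuous_on_sym_eig:
  fixes g A :: "'b::topological_space \<Rightarrow> real ^ 'n ^ 'n"
  assumes "\<And>i j. continuous_on X (\<lambda>p. g p $ i $ j)" "\<And>i j. continuous_on X (\<lambda>p. A p $ i $ j)"
    and pd: "\<And>p. p \<in> X \<Longrightarrow> pos_def (g p)" and sym: "\<And>p. p \<in> X \<Longrightarrow> transpose (A p) = A p"
  shows "continuous_on X (\<lambda>p. sym_eig m (g p) (A p))"
proof -
  let ?F = "\<lambda>p. esym_poly UNIV (($) (eigenvalues_of (matrix_inv (g p) ** A p)))"
  have inv: "continuous_on X (\<lambda>p. matrix_inv (g p) $ i $ j)" for i j
    by (intro continuous_on_matrix_inv assms pos_def_det)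
  have "continuous_on X (\<lambda>p. det (mat 1 + x *\<^sub>R (matrix_inv (g p) ** A p)))" for x
    by (intro continuous_on_det)
      (simp add: matrix_matrix_mult_def, intro continuous_intros inv assms)
  then have "continuous_on X (\<lambda>p. poly (?F p) x)" for x
    using pd sym by (simp add: poly_sym_eig cong: continuous_on_cong)
  then have "continuous_on X (\<lambda>p. coeff (?F p) m)"
    by (intro continuous_on_coeff[where n = "CARD('n)"] degree_esym_poly) auto
  then show ?thesis by (simp add: coeff_esym_poly sym_eig_def)
qed

section \<open>Partial derivatives\<close>

lemma has_real_derivative_along_line:
  fixes h :: "'b::real_normed_vector \<Rightarrow> real"
  assumes "h differentiable (at (p + s *\<^sub>R v))"
  shows "((\<lambda>s. h (p + s *\<^sub>R v)) has_real_derivative frechet_derivative h (at (p + s *\<^sub>R v)) v) (at s)"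
proof -
  let ?D = "frechet_derivative h (at (p + s *\<^sub>R v))"
  have D: "(h has_derivative ?D) (at (p + s *\<^sub>R v))" using assms frechet_derivative_works by blast
  have "((\<lambda>s. p + s *\<^sub>R v) has_derivative (\<lambda>t. t *\<^sub>R v)) (at s)"
    by (auto intro!: derivative_eq_intros)
  from has_derivative_compose[OF this, of h ?D] D
  have "((\<lambda>s. h (p + s *\<^sub>R v)) has_derivative (\<lambda>t. ?D (t *\<^sub>R v))) (at s)" by simp
  moreover have "(\<lambda>t. ?D (t *\<^sub>R v)) = (*) (?D v)"
    using linear_frechet_derivative[OF assms] by (simp add: linear_cmul fun_eq_iff mult.commute)
  ultimately show ?thesis by (simp add: has_field_derivative_def)
qed

lemma pd_eqI:
  assumes "(h has_derivative D) (at x)"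
  shows "pd i h x = D (axis i 1)"
  using frechet_derivative_at[OF assms] by (simp add: pd_def)

lemma frechet_derivative_eq_sum_pd:
  assumes "h differentiable (at x)"
  shows "frechet_derivative h (at x) v = (\<Sum>i\<in>UNIV. v $ i * pd i h x)"
proof -
  have "linear (frechet_derivative h (at x))" by (rule linear_frechet_derivative[OF assms])
  then have "frechet_derivative h (at x) (\<Sum>i\<in>UNIV. v $ i *\<^sub>R axis i 1) = (\<Sum>i\<in>UNIV. v $ i * pd i h x)"
    by (simp add: linear_sum linear_cmul pd_def)
  moreover have "(\<Sum>i\<in>UNIV. v $ i *\<^sub>R axis i 1) = v"
    using basis_expansion[of v] by (simp add: scalar_mult_eq_scaleR)
  ultimately show ?thesis by simp
qed

lemma pd_cong:
  assumes "open U" "x \<in> U" "\<And>y. y \<in> U \<Longrightarrow> f y = g y"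
  shows "pd i f x = pd i g x"
proof -
  have "(f has_derivative D) (at x) \<longleftrightarrow> (g has_derivative D) (at x)" for D
    using assms by (metis has_derivative_transform_within_open)
  then show ?thesis by (simp add: pd_def frechet_derivative_def)
qed

lemma differentiable_cong_open:
  assumes "open U" "x \<in> U" "\<And>y. y \<in> U \<Longrightarrow> f y = g y" "f differentiable (at x)"
  shows "g differentiable (at x)"
  using assms unfolding differentiable_def by (metis has_derivative_transform_within_open)

lemma pd_sum_mult:
  assumes "finite F" "\<And>a. a \<in> F \<Longrightarrow> f a differentiable (at x)" "\<And>a. a \<in> F \<Longrightarrow> g a differentiable (at x)"
  shows "pd i (\<lambda>x. \<Sum>a\<in>F. f a x * g a x) x
    = (\<Sum>a\<in>F. pd i (f a) x * g a x + f a x * pd i (g a) x)"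
    and "(\<lambda>x. \<Sum>a\<in>F. f a x * g a x) differentiable (at x)"
proof -
  have "((\<lambda>x. \<Sum>a\<in>F. f a x * g a x) has_derivative
     (\<lambda>v. \<Sum>a\<in>F. f a x * frechet_derivative (g a) (at x) v + frechet_derivative (f a) (at x) v * g a x)) (at x)"
    using assms by (intro has_derivative_sum has_derivative_mult) (auto simp flip: frechet_derivative_works)
  note D = this
  show "pd i (\<lambda>x. \<Sum>a\<in>F. f a x * g a x) x
    = (\<Sum>a\<in>F. pd i (f a) x * g a x + f a x * pd i (g a) x)"
    "(\<lambda>x. \<Sum>a\<in>F. f a x * g a x) differentiable (at x)"
    by (auto simp: pd_eqI[OF D] pd_def[of i "f _"] pd_def[of i "g _"]
        add.commute intro: D differentiableI)
qed

lemma pd_chain: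
  fixes \<phi> :: "real ^ 'n \<Rightarrow> real ^ 'm"
  assumes "\<phi> differentiable (at x)" "f differentiable (at (\<phi> x))"
  shows "pd i (\<lambda>x. f (\<phi> x)) x = (\<Sum>a\<in>UNIV. pd a f (\<phi> x) * pd i (\<lambda>x. \<phi> x $ a) x)"
proof -
  let ?D = "frechet_derivative \<phi> (at x)"
  have D: "(\<phi> has_derivative ?D) (at x)" using assms frechet_derivative_works by blast
  have comp: "pd i (\<lambda>x. \<phi> x $ a) x = ?D (axis i 1) $ a" for a
    by (rule pd_eqI) (rule bounded_linear.has_derivative[OF bounded_linear_vec_nth D])
  have "((\<lambda>x. f (\<phi> x)) has_derivative (\<lambda>v. frechet_derivative f (at (\<phi> x)) (?D v))) (at x)"
    using has_derivative_compose[OF D, of f] assms frechet_derivative_works by blast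
  then have "pd i (\<lambda>x. f (\<phi> x)) x = frechet_derivative f (at (\<phi> x)) (?D (axis i 1))" by (rule pd_eqI)
  then show ?thesis
    by (simp add: frechet_derivative_eq_sum_pd[OF assms(2)] comp mult.commute)
qed

section \<open>Symmetry of second derivatives\<close>

text \<open>The mean value theorem is applied first in the direction \<open>v\<close> to the increment of \<open>h\<close> in the
  direction \<open>w\<close>, then in the direction \<open>w\<close>.\<close>

lemma second_difference_mean_value:
  fixes h :: "'b::real_normed_vector \<Rightarrow> real"
  assumes t: "0 < t" and B: "\<And>a b. 0 \<le> a \<Longrightarrow> a \<le> t \<Longrightarrow> 0 \<le> b \<Longrightarrow> b \<le> t \<Longrightarrow> x + a *\<^sub>R v + b *\<^sub>R w \<in> X"
    and d: "\<And>y. y \<in> X \<Longrightarrow> h differentiable (at y)"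
    and dd: "\<And>y. y \<in> X \<Longrightarrow> (\<lambda>y. frechet_derivative h (at y) v) differentiable (at y)"
  shows "\<exists>a b. 0 \<le> a \<and> a \<le> t \<and> 0 \<le> b \<and> b \<le> t \<and>
    h (x + t *\<^sub>R v + t *\<^sub>R w) - h (x + t *\<^sub>R v) - h (x + t *\<^sub>R w) + h x
      = t * t * frechet_derivative (\<lambda>y. frechet_derivative h (at y) v) (at (x + a *\<^sub>R v + b *\<^sub>R w)) w"
proof -
  let ?H = "\<lambda>y. frechet_derivative h (at y) v"
  have "((\<lambda>s. h (x + t *\<^sub>R w + s *\<^sub>R v) - h (x + s *\<^sub>R v)) has_real_derivative
      ?H (x + t *\<^sub>R w + s *\<^sub>R v) - ?H (x + s *\<^sub>R v)) (at s)" if "0 \<le> s" "s \<le> t" for s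
    using that t B[of s t] B[of s 0]
    by (intro derivative_intros has_real_derivative_along_line d) (auto simp: add_ac)
  from MVT2[OF t this] obtain a where a: "0 < a" "a < t"
    and 1: "(h (x + t *\<^sub>R w + t *\<^sub>R v) - h (x + t *\<^sub>R v)) - (h (x + t *\<^sub>R w + 0 *\<^sub>R v) - h (x + 0 *\<^sub>R v))
      = (t - 0) * (?H (x + t *\<^sub>R w + a *\<^sub>R v) - ?H (x + a *\<^sub>R v))"
    by blast
  have "((\<lambda>s. ?H (x + a *\<^sub>R v + s *\<^sub>R w)) has_real_derivative
      frechet_derivative ?H (at (x + a *\<^sub>R v + s *\<^sub>R w)) w) (at s)" if "0 \<le> s" "s \<le> t" for s
    using that a B[of a s] by (intro has_real_derivative_along_line dd) auto
  from MVT2[OF t this] obtain b where b: "0 < b" "b < t"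
    and 2: "?H (x + a *\<^sub>R v + t *\<^sub>R w) - ?H (x + a *\<^sub>R v + 0 *\<^sub>R w)
      = (t - 0) * frechet_derivative ?H (at (x + a *\<^sub>R v + b *\<^sub>R w)) w"
    by blast
  have e1: "h (x + t *\<^sub>R v + t *\<^sub>R w) - h (x + t *\<^sub>R v) - h (x + t *\<^sub>R w) + h x
      = t * (?H (x + a *\<^sub>R v + t *\<^sub>R w) - ?H (x + a *\<^sub>R v))"
    using 1 by (simp add: add_ac)
  have e2: "?H (x + a *\<^sub>R v + t *\<^sub>R w) - ?H (x + a *\<^sub>R v)
      = t * frechet_derivative ?H (at (x + a *\<^sub>R v + b *\<^sub>R w)) w"
    using 2 by simp
  show ?thesis
    using a b e1 unfolding e2 by (intro exI[of _ a] exI[of _ b]) (simp add: mult.assoc)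
qed

text \<open>The second difference is symmetric in \<open>v\<close> and \<open>w\<close>, and divided by \<open>t\<^sup>2\<close> it is a value of either
  mixed derivative at a point close to \<open>x\<close>.\<close>

lemma frechet_derivative_symmetric:
  fixes h :: "'b::real_normed_vector \<Rightarrow> real"
  assumes "open X" "x \<in> X"
    and d: "\<And>y. y \<in> X \<Longrightarrow> h differentiable (at y)"
    and dd: "\<And>y v. y \<in> X \<Longrightarrow> (\<lambda>y. frechet_derivative h (at y) v) differentiable (at y)"
    and cont: "\<And>v w. continuous_on X (\<lambda>y. frechet_derivative (\<lambda>y. frechet_derivative h (at y) v) (at y) w)"
  shows "frechet_derivative (\<lambda>y. frechet_derivative h (at y) v) (at x) w
    = frechet_derivative (\<lambda>y. frechet_derivative h (at y) w) (at x) v"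
proof (rule ccontr)
  let ?HH = "\<lambda>v w y. frechet_derivative (\<lambda>y. frechet_derivative h (at y) v) (at y) w"
  assume ne: "?HH v w x \<noteq> ?HH w v x"
  define e where "e = \<bar>?HH v w x - ?HH w v x\<bar> / 2"
  have e: "e > 0" using ne by (simp add: e_def)
  obtain r0 where r0: "r0 > 0" "ball x r0 \<subseteq> X" using assms(1,2) open_contains_ball by blast
  have "\<exists>r>0. \<forall>y\<in>X. dist y x < r \<longrightarrow> dist (?HH v w y) (?HH v w x) < e" for v w
    using cont[of v w] assms(2) e unfolding continuous_on_iff by blast
  then obtain r1 r2 where r1: "r1 > 0" "\<And>y. y \<in> X \<Longrightarrow> dist y x < r1 \<Longrightarrow> dist (?HH v w y) (?HH v w x) < e"
    and r2: "r2 > 0" "\<And>y. y \<in> X \<Longrightarrow> dist y x < r2 \<Longrightarrow> dist (?HH w v y) (?HH w v x) < e"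
    by metis
  define r where "r = min r0 (min r1 r2)"
  have r: "r > 0" "r \<le> r0" "r \<le> r1" "r \<le> r2" using r0 r1 r2 by (auto simp: r_def)
  define n where "n = norm v + norm w + 1"
  have n: "n > 0" using norm_ge_zero[of v] norm_ge_zero[of w] unfolding n_def by linarith
  (* The parallelogram with sides t v and t w at x stays within distance r / 2 of x. *)
  define t where "t = r / (2 * n)"
  have t: "t > 0" using r n by (simp add: t_def)
  have near: "dist (x + a *\<^sub>R v + b *\<^sub>R w) x < r" if "0 \<le> a" "a \<le> t" "0 \<le> b" "b \<le> t" for a b
  proof -
    have "dist (x + a *\<^sub>R v + b *\<^sub>R w) x = norm (a *\<^sub>R v + b *\<^sub>R w)"
      by (simp add: dist_norm add.assoc)
    also have "\<dots> \<le> a * norm v + b * norm w"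
      using norm_triangle_ineq[of "a *\<^sub>R v" "b *\<^sub>R w"] that by simp
    also have "\<dots> \<le> t * norm v + t * norm w" using that by (intro add_mono mult_right_mono) auto
    also have "\<dots> \<le> t * n" using t by (simp add: n_def algebra_simps)
    also have "\<dots> < r" using r n by (simp add: t_def)
    finally show ?thesis .
  qed
  then have inX: "x + a *\<^sub>R v + b *\<^sub>R w \<in> X" if "0 \<le> a" "a \<le> t" "0 \<le> b" "b \<le> t" for a b
    using that r r0(2) by (meson dist_commute_lessI less_le_trans mem_ball subsetD)
  have sw: "x + a *\<^sub>R w + b *\<^sub>R v = x + b *\<^sub>R v + a *\<^sub>R w" for a b by (simp add: add_ac)
  have "\<exists>a b. 0 \<le> a \<and> a \<le> t \<and> 0 \<le> b \<and> b \<le> t \<and>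
    h (x + t *\<^sub>R v + t *\<^sub>R w) - h (x + t *\<^sub>R v) - h (x + t *\<^sub>R w) + h x
      = t * t * ?HH v w (x + a *\<^sub>R v + b *\<^sub>R w)"
    by (rule second_difference_mean_value[OF t, of x v w X h, OF inX d dd])
  then obtain a b where ab: "0 \<le> a" "a \<le> t" "0 \<le> b" "b \<le> t"
    "h (x + t *\<^sub>R v + t *\<^sub>R w) - h (x + t *\<^sub>R v) - h (x + t *\<^sub>R w) + h x
      = t * t * ?HH v w (x + a *\<^sub>R v + b *\<^sub>R w)" by blast
  have "\<exists>a b. 0 \<le> a \<and> a \<le> t \<and> 0 \<le> b \<and> b \<le> t \<and>
    h (x + t *\<^sub>R w + t *\<^sub>R v) - h (x + t *\<^sub>R w) - h (x + t *\<^sub>R v) + h x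
      = t * t * ?HH w v (x + a *\<^sub>R w + b *\<^sub>R v)"
    by (rule second_difference_mean_value[OF t, of x w v X h, OF _ d dd]) (auto simp: sw intro: inX)
  then obtain a' b' where ab': "0 \<le> a'" "a' \<le> t" "0 \<le> b'" "b' \<le> t"
    "h (x + t *\<^sub>R w + t *\<^sub>R v) - h (x + t *\<^sub>R w) - h (x + t *\<^sub>R v) + h x
      = t * t * ?HH w v (x + a' *\<^sub>R w + b' *\<^sub>R v)" by blast
  have "t * t * ?HH v w (x + a *\<^sub>R v + b *\<^sub>R w) = t * t * ?HH w v (x + b' *\<^sub>R v + a' *\<^sub>R w)"
    using ab(5) ab'(5) unfolding sw by linarith
  then have "?HH v w (x + a *\<^sub>R v + b *\<^sub>R w) = ?HH w v (x + b' *\<^sub>R v + a' *\<^sub>R w)"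
    using t by simp
  moreover have "\<bar>?HH v w (x + a *\<^sub>R v + b *\<^sub>R w) - ?HH v w x\<bar> < e"
    using r1(2)[OF inX] near r ab(1-4) by (smt (verit) dist_real_def)
  moreover have "\<bar>?HH w v (x + b' *\<^sub>R v + a' *\<^sub>R w) - ?HH w v x\<bar> < e"
    using r2(2)[OF inX] near r ab'(1-4) by (smt (verit) dist_real_def)
  moreover have False if "p = q" "\<bar>p - c\<bar> < e" "\<bar>q - d\<bar> < e" "e = \<bar>c - d\<bar> / 2" for p q c d e :: real
  proof -
    have "\<bar>c - d\<bar> \<le> \<bar>p - c\<bar> + \<bar>q - d\<bar>" using that(1) by arith
    then show False using that(2-4) by simp
  qed
  ultimately show False using e_def by blast
qed

lemma Ck_on_1D:
  assumes "Ck_on 1 X h"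
  shows "x \<in> X \<Longrightarrow> h differentiable (at x)" "continuous_on X (\<lambda>x. frechet_derivative h (at x) v)"
    "continuous_on X h"
proof -
  show d: "h differentiable (at x)" if "x \<in> X" for x using assms that by simp
  show "continuous_on X (\<lambda>x. frechet_derivative h (at x) v)" using assms by simp
  show "continuous_on X h"
    using d by (simp add: continuous_at_imp_continuous_on differentiable_imp_continuous_within)
qed

lemma Ck_on_2D:
  assumes "Ck_on 2 X h"
  shows "x \<in> X \<Longrightarrow> h differentiable (at x)" "Ck_on 1 X (\<lambda>x. frechet_derivative h (at x) v)"
proof -
  have *: "(\<forall>x\<in>X. h differentiable (at x)) \<and> (\<forall>v. Ck_on 1 X (\<lambda>x. frechet_derivative h (at x) v))"
    using assms unfolding numeral_2_eq_2 One_nat_def by (subst (asm) Ck_on.simps(2))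
  show "h differentiable (at x)" if "x \<in> X" for x using * that by blast
  show "Ck_on 1 X (\<lambda>x. frechet_derivative h (at x) v)" using * by blast
qed

lemma Ck_on_2_pd:
  fixes h :: "real ^ 'n \<Rightarrow> real"
  assumes "Ck_on 2 X h"
  shows "x \<in> X \<Longrightarrow> pd i h differentiable (at x)" "continuous_on X (pd i h)"
    "continuous_on X (pd i (pd j h))"
  using Ck_on_1D[OF Ck_on_2D(2)[OF assms]] by (auto simp: pd_def[abs_def])

lemma pd_commute:
  fixes h :: "real ^ 'n \<Rightarrow> real"
  assumes "Ck_on 2 X h" "open X" "x \<in> X"
  shows "pd i (pd j h) x = pd j (pd i h) x"
  unfolding pd_def[abs_def]
  by (rule frechet_derivative_symmetric[OF assms(2,3)])
    (use Ck_on_2D[OF assms(1)] Ck_on_1D[OF Ck_on_2D(2)[OF assms(1)]] in blast)+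

text \<open>If the second derivative in the direction \<open>v\<close> were negative, the first derivative along the line
  through \<open>x\<close> would be negative shortly after \<open>x\<close>, and \<open>h\<close> would drop below its minimum.\<close>

lemma local_min_second_derivative:
  fixes h :: "real ^ 'n \<Rightarrow> real"
  assumes "Ck_on 2 X h" "open X" "x \<in> X" and min: "\<And>y. y \<in> X \<Longrightarrow> h x \<le> h y"
  shows "pd i h x = 0" and "0 \<le> v \<bullet> ((\<chi> i j. pd i (pd j h) x) *v v)"
proof -
  obtain r where r: "r > 0" "ball x r \<subseteq> X" using assms(2,3) open_contains_ball by blast
  note d = Ck_on_2D(1)[OF assms(1)]
  have z: "frechet_derivative h (at x) = (\<lambda>v. 0)"
  proof (rule differential_zero_maxmin[OF assms(3,2)])
    show "(h has_derivative frechet_derivative h (at x)) (at x)"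
      using d[OF assms(3)] frechet_derivative_works by blast
  qed (use min in blast)
  then show "pd i h x = 0" by (simp add: pd_def)
  let ?f' = "\<lambda>s. \<Sum>j\<in>UNIV. v $ j * pd j h (x + s *\<^sub>R v)"
  define q where "q = v \<bullet> ((\<chi> i j. pd i (pd j h) x) *v v)"
  define n where "n = norm v + 1"
  have n: "n > 0" using norm_ge_zero[of v] unfolding n_def by linarith
  have inX: "x + s *\<^sub>R v \<in> X" if "0 \<le> s" "s < r / n" for s
  proof -
    have "norm (s *\<^sub>R v) \<le> s * n" using that by (simp add: n_def mult_left_mono)
    also have "\<dots> < r" using that n by (simp add: pos_less_divide_eq)
    finally show ?thesis using r(2) by (auto simp: dist_norm)
  qed
  show "0 \<le> v \<bullet> ((\<chi> i j. pd i (pd j h) x) *v v)"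
  proof (rule ccontr)
    assume "\<not> ?thesis"
    then have q: "q < 0" by (simp add: q_def)
    have "((\<lambda>s. pd j h (x + s *\<^sub>R v)) has_real_derivative (\<Sum>i\<in>UNIV. v $ i * pd i (pd j h) x)) (at 0)" for j
      using has_real_derivative_along_line[of "pd j h" x 0 v] Ck_on_2_pd(1)[OF assms(1,3), of j]
      by (simp add: frechet_derivative_eq_sum_pd)
    then have "(?f' has_real_derivative (\<Sum>j\<in>UNIV. v $ j * (\<Sum>i\<in>UNIV. v $ i * pd i (pd j h) x))) (at 0)"
      by (intro DERIV_sum DERIV_cmult)
    also have "(\<Sum>j\<in>UNIV. v $ j * (\<Sum>i\<in>UNIV. v $ i * pd i (pd j h) x)) = q"
      by (simp add: q_def inner_vec_def matrix_vector_mult_def sum_distrib_left mult_ac)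
        (subst sum.swap, simp add: mult.left_commute)
    finally have "(?f' has_real_derivative q) (at 0)" .
    from DERIV_neg_dec_right[OF this q] obtain e where e: "e > 0"
      "\<And>s. 0 < s \<Longrightarrow> s < e \<Longrightarrow> ?f' (0 + s) < ?f' 0" by blast
    have f'0: "?f' 0 = 0"
      using frechet_derivative_eq_sum_pd[OF d[OF assms(3)], of v] z by simp
    define t where "t = min e (r / n) / 2"
    have t: "0 < t" "t < e" "t < r / n" using e r n by (auto simp: t_def min_def field_simps)
    have "((\<lambda>s. h (x + s *\<^sub>R v)) has_real_derivative ?f' s) (at s)" if "0 \<le> s" "s \<le> t" for s
      using has_real_derivative_along_line[of h x s v] d[OF inX[of s]] that t
      by (simp add: frechet_derivative_eq_sum_pd)
    from MVT2[OF t(1) this] obtain s where s: "0 < s" "s < t"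
      "h (x + t *\<^sub>R v) - h (x + 0 *\<^sub>R v) = (t - 0) * ?f' s" by blast
    have "?f' s < 0" using e(2)[of s] s t f'0 by simp
    then have "h (x + t *\<^sub>R v) < h x" using s(3) t mult_pos_neg[of t "?f' s"] by simp
    moreover have "h x \<le> h (x + t *\<^sub>R v)" using min inX[of t] t by simp
    ultimately show False by simp
  qed
qed

section \<open>Charts of a Riemannian manifold\<close>

text \<open>The derivatives in the definition are taken at points of the whole space, so on an open set they
  depend only on the values there.\<close>

lemma Ck_on_cong_open:
  assumes "open X" "\<And>x. x \<in> X \<Longrightarrow> f x = g x" "Ck_on m X f"
  shows "Ck_on m X g"
  using assms(2,3)
proof (induction m arbitrary: f g)
  case 0
  then show ?case by (simp cong: continuous_on_cong)
next
  case (Suc m)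
  have "frechet_derivative f (at x) v = frechet_derivative g (at x) v" if "x \<in> X" for x v
    using frechet_derivative_transform_within_open[of f x X g] Suc.prems assms(1) that by auto
  then have "Ck_on m X (\<lambda>x. frechet_derivative g (at x) v)" for v
    using Suc.IH[of "\<lambda>x. frechet_derivative f (at x) v" "\<lambda>x. frechet_derivative g (at x) v"] Suc.prems(2)
    by simp
  moreover have "g differentiable (at x)" if "x \<in> X" for x
    using differentiable_cong_open[OF assms(1) that] Suc.prems that by auto
  ultimately show ?case by simp
qed

lemma Ck_on_bounded_linear:
  assumes "open X" "bounded_linear L" "Ck_on m X h"
  shows "Ck_on m X (\<lambda>x. L (h x))"
  using assms(3)
proof (induction m arbitrary: h)
  case 0
  then show ?case using bounded_linear.continuous_on[OF assms(2)] by simp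
next
  case (Suc m)
  have D: "((\<lambda>x. L (h x)) has_derivative (\<lambda>v. L (frechet_derivative h (at x) v))) (at x)" if "x \<in> X" for x
  proof (rule bounded_linear.has_derivative[OF assms(2)])
    show "(h has_derivative frechet_derivative h (at x)) (at x)"
      using Suc.prems that by (simp flip: frechet_derivative_works)
  qed
  have "Ck_on m X (\<lambda>x. frechet_derivative (\<lambda>x. L (h x)) (at x) v)" for v
  proof (rule Ck_on_cong_open[OF assms(1)])
    show "Ck_on m X (\<lambda>x. L (frechet_derivative h (at x) v))" using Suc by auto
    show "L (frechet_derivative h (at x) v) = frechet_derivative (\<lambda>x. L (h x)) (at x) v" if "x \<in> X" for x
      using frechet_derivative_at[OF D[OF that]] by metis
  qed
  then show ?case using D by (auto simp: differentiable_def)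
qed

lemma bounded_linear_matrix_entry: "bounded_linear (\<lambda>M :: real ^ 'n ^ 'm. M $ i $ j)"
  by (rule bounded_linear_compose[OF bounded_linear_vec_nth bounded_linear_vec_nth])

lemma congruence_entry:
  fixes J M :: "real ^ 'n ^ 'n"
  shows "(transpose J ** M ** J) $ i $ j = (\<Sum>a\<in>UNIV. \<Sum>b\<in>UNIV. J $ a $ i * J $ b $ j * M $ a $ b)"
  unfolding matrix_entry_dot inner_vec_def matrix_vector_mult_def column_def
  by (simp add: sum_distrib_left mult_ac)

locale riemannian_atlas =
  fixes \<A> :: "('a::topological_space, 'n::finite) chart set" and g :: "('a, 'n) tensor02"
  assumes atlas: "smooth_atlas \<A>" and metric: "riemannian_metric \<A> g"
begin

abbreviation coords :: "('a, 'n) chart \<Rightarrow> (real ^ 'n) set" where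
  "coords c \<equiv> snd c ` fst c"

lemma chart:
  assumes "c \<in> \<A>"
  shows "open (fst c)" "open (coords c)" "homeomorphism (fst c) (coords c) (snd c) (chart_inv c)"
  using assms atlas by (auto simp: smooth_atlas_def is_chart_def chart_inv_def)

lemma chart_inv_left [simp]: "c \<in> \<A> \<Longrightarrow> p \<in> fst c \<Longrightarrow> chart_inv c (snd c p) = p"
  using chart(3) by (metis homeomorphism_apply1)

lemma chart_inv_right [simp]: "c \<in> \<A> \<Longrightarrow> x \<in> coords c \<Longrightarrow> snd c (chart_inv c x) = x"
  using chart(3) by (metis homeomorphism_apply2)

lemma in_some_chart: "\<exists>c\<in>\<A>. p \<in> fst c"
  using atlas by (auto simp: smooth_atlas_def)

lemma open_overlap:
  assumes "c \<in> \<A>" "open U" "U \<subseteq> fst c"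
  shows "open (snd c ` U)"
proof -
  have "openin (top_of_set (coords c)) (snd c ` U)"
    using homeomorphism_imp_open_map[OF chart(3)[OF assms(1)], of U] assms by (simp add: open_subset)
  then show ?thesis using chart(2)[OF assms(1)] openin_open_eq by blast
qed

lemma continuous_on_chart:
  assumes "c \<in> \<A>" "continuous_on (coords c) h"
  shows "continuous_on (fst c) (\<lambda>p. h (snd c p))"
  using continuous_on_compose2[OF assms(2)] chart(3)[OF assms(1)] by (auto simp: homeomorphism_def)

lemma metric_pos_def: "c \<in> \<A> \<Longrightarrow> p \<in> fst c \<Longrightarrow> pos_def (g c p)"
  using metric by (auto simp: riemannian_metric_def symmetric_tensor_def pos_def_def)

lemma metric_sym: "c \<in> \<A> \<Longrightarrow> p \<in> fst c \<Longrightarrow> g c p $ i $ j = g c p $ j $ i"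
proof -
  assume "c \<in> \<A>" "p \<in> fst c"
  then have "transpose (g c p) = g c p" using metric_pos_def by (simp add: pos_def_def)
  from arg_cong[OF this, of "\<lambda>M. M $ j $ i"] show ?thesis by (simp add: transpose_def)
qed

definition metric_entry :: "('a, 'n) chart \<Rightarrow> 'n \<Rightarrow> 'n \<Rightarrow> real ^ 'n \<Rightarrow> real" where
  "metric_entry c i j x = g c (chart_inv c x) $ i $ j"

lemma metric_entry_C2: "c \<in> \<A> \<Longrightarrow> Ck_on 2 (coords c) (metric_entry c i j)"
proof -
  assume c: "c \<in> \<A>"
  then have "Ck_on 2 (coords c) (\<lambda>x. g c (chart_inv c x))"
    using metric by (simp add: riemannian_metric_def Ck_tensor_def)
  from Ck_on_bounded_linear[OF chart(2)[OF c] bounded_linear_matrix_entry this]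
  show ?thesis by (simp add: metric_entry_def[abs_def])
qed

lemma metric_pd_eq: "metric_pd g c p l i j = pd l (metric_entry c i j) (snd c p)"
  by (simp add: metric_pd_def metric_entry_def[abs_def])

lemma metric_pd_sym:
  assumes "c \<in> \<A>" "p \<in> fst c"
  shows "metric_pd g c p l i j = metric_pd g c p l j i"
  unfolding metric_pd_eq
  by (rule pd_cong[OF chart(2)[OF assms(1)]]) (use assms in \<open>auto simp: metric_entry_def metric_sym\<close>)

lemma matrix_inv_metric_sym:
  assumes "c \<in> \<A>" "p \<in> fst c"
  shows "matrix_inv (g c p) $ i $ j = matrix_inv (g c p) $ j $ i"
proof -
  have "transpose (0 :: real ^ 'n ^ 'n) = 0" by (simp add: transpose_def vec_eq_iff)
  then obtain B :: "real ^ 'n ^ 'n" where "matrix_inv (g c p) = B ** transpose B"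
    using simultaneous_diagonalization[OF metric_pos_def[OF assms]] by blast
  then have "transpose (matrix_inv (g c p)) = matrix_inv (g c p)" by (simp add: matrix_transpose_mul)
  from arg_cong[OF this, of "\<lambda>M. M $ j $ i"] show ?thesis by (simp add: transpose_def)
qed

text \<open>The correction term by which the Hessian differs from the matrix of second partial derivatives.\<close>

definition christoffel_du :: "('a \<Rightarrow> real) \<Rightarrow> ('a, 'n) chart \<Rightarrow> 'a \<Rightarrow> 'n \<Rightarrow> 'n \<Rightarrow> real" where
  "christoffel_du u c p i j = (\<Sum>m\<in>UNIV. christoffel g c p m i j * differential u c p $ m)"

text \<open>Contracting the Christoffel symbols of the first kind with the gradient avoids the inverse metric,
  which makes the change of coordinates tractable.\<close>

lemma christoffel_contract:
  assumes "c \<in> \<A>" "p \<in> fst c"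
  shows "christoffel_du u c p i j
    = (1/2) * (\<Sum>l\<in>UNIV. gradient g u c p $ l *
       (metric_pd g c p i j l + metric_pd g c p j i l - metric_pd g c p l i j))"
proof -
  let ?T = "\<lambda>l. metric_pd g c p i j l + metric_pd g c p j i l - metric_pd g c p l i j"
  have "christoffel_du u c p i j
    = (1/2) * (\<Sum>m\<in>UNIV. \<Sum>l\<in>UNIV. matrix_inv (g c p) $ m $ l * differential u c p $ m * ?T l)"
    unfolding christoffel_def christoffel_du_def
    by (simp add: sum_distrib_left sum_distrib_right mult_ac)
  also have "(\<Sum>m\<in>UNIV. \<Sum>l\<in>UNIV. matrix_inv (g c p) $ m $ l * differential u c p $ m * ?T l)
    = (\<Sum>l\<in>UNIV. (\<Sum>m\<in>UNIV. matrix_inv (g c p) $ m $ l * differential u c p $ m) * ?T l)"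
    by (subst sum.swap) (simp add: sum_distrib_right)
  also have "\<dots> = (\<Sum>l\<in>UNIV. gradient g u c p $ l * ?T l)"
    by (simp add: gradient_def matrix_vector_mult_def matrix_inv_metric_sym[OF assms, of _ l for l])
  finally show ?thesis .
qed

section \<open>Change of coordinates\<close>

definition transition :: "('a, 'n) chart \<Rightarrow> ('a, 'n) chart \<Rightarrow> real ^ 'n \<Rightarrow> real ^ 'n" where
  "transition c d = snd d \<circ> chart_inv c"

definition jac :: "('a, 'n) chart \<Rightarrow> ('a, 'n) chart \<Rightarrow> 'n \<Rightarrow> 'n \<Rightarrow> real ^ 'n \<Rightarrow> real" where
  "jac c d a i = pd i (\<lambda>x. transition c d x $ a)"

abbreviation overlap :: "('a, 'n) chart \<Rightarrow> ('a, 'n) chart \<Rightarrow> (real ^ 'n) set" where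
  "overlap c d \<equiv> snd c ` (fst c \<inter> fst d)"

lemma overlap_facts:
  assumes "c \<in> \<A>" "d \<in> \<A>"
  shows "open (overlap c d)"
    and "x \<in> overlap c d \<Longrightarrow> x \<in> coords c"
    and "x \<in> overlap c d \<Longrightarrow> transition c d x \<in> coords d"
    and "x \<in> overlap c d \<Longrightarrow> chart_inv c x \<in> fst c \<inter> fst d"
    and "x \<in> overlap c d \<Longrightarrow> chart_inv d (transition c d x) = chart_inv c x"
    and "p \<in> fst c \<inter> fst d \<Longrightarrow> transition c d (snd c p) = snd d p"
    and "Ck_on m (overlap c d) (transition c d)"
    and "Ck_on m (overlap c d) (\<lambda>x. transition c d x $ a)"
proof -
  show op: "open (overlap c d)"
    using open_overlap[of c "fst c \<inter> fst d"] assms chart(1) by blast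
  show "x \<in> overlap c d \<Longrightarrow> x \<in> coords c" "x \<in> overlap c d \<Longrightarrow> transition c d x \<in> coords d"
    "x \<in> overlap c d \<Longrightarrow> chart_inv c x \<in> fst c \<inter> fst d"
    "x \<in> overlap c d \<Longrightarrow> chart_inv d (transition c d x) = chart_inv c x"
    "p \<in> fst c \<inter> fst d \<Longrightarrow> transition c d (snd c p) = snd d p"
    using assms by (auto simp: transition_def)
  show "Ck_on m (overlap c d) (transition c d)"
    using atlas assms by (auto simp: smooth_atlas_def smooth_on_def transition_def)
  then show "Ck_on m (overlap c d) (\<lambda>x. transition c d x $ a)"
    by (rule Ck_on_bounded_linear[OF op bounded_linear_vec_nth])
qed

lemma transition_differentiable:
  "c \<in> \<A> \<Longrightarrow> d \<in> \<A> \<Longrightarrow> x \<in> overlap c d \<Longrightarrow> transition c d differentiable (at x)"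
  by (rule Ck_on_1D(1)[OF overlap_facts(7)])

lemma jacobian_eq:
  assumes "c \<in> \<A>" "d \<in> \<A>" "x \<in> overlap c d"
  shows "jacobian (snd d \<circ> chart_inv c) (at x) = (\<chi> a i. jac c d a i x)"
proof -
  have D: "(transition c d has_derivative frechet_derivative (transition c d) (at x)) (at x)"
    using transition_differentiable[OF assms] frechet_derivative_works by blast
  have "jac c d a i x = frechet_derivative (transition c d) (at x) (axis i 1) $ a" for a i
    unfolding jac_def by (rule pd_eqI) (rule bounded_linear.has_derivative[OF bounded_linear_vec_nth D])
  then show ?thesis by (simp add: jacobian_def matrix_def transition_def)
qed

lemma tensor_transform:
  assumes "tensor_field \<A> T" "c \<in> \<A>" "d \<in> \<A>" "p \<in> fst c \<inter> fst d"
  shows "T c p $ i $ j = (\<Sum>a\<in>UNIV. \<Sum>b\<in>UNIV.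
    jac c d a i (snd c p) * jac c d b j (snd c p) * T d p $ a $ b)"
proof -
  have "snd c p \<in> overlap c d" using assms by auto
  then have "T c p = transpose (\<chi> a i. jac c d a i (snd c p)) ** T d p ** (\<chi> a i. jac c d a i (snd c p))"
    using assms jacobian_eq[of c d "snd c p"] unfolding tensor_field_def Let_def by metis
  then show ?thesis by (simp add: congruence_entry)
qed

lemma pd_chart:
  assumes "c \<in> \<A>" "d \<in> \<A>" "x \<in> overlap c d" and h: "h differentiable (at (transition c d x))"
  shows "pd i (\<lambda>x. h (transition c d x)) x = (\<Sum>a\<in>UNIV. pd a h (transition c d x) * jac c d a i x)"
    and "(\<lambda>x. h (transition c d x)) differentiable (at x)"
proof -
  note dt = transition_differentiable[OF assms(1-3)]
  show "pd i (\<lambda>x. h (transition c d x)) x = (\<Sum>a\<in>UNIV. pd a h (transition c d x) * jac c d a i x)"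
    unfolding jac_def by (rule pd_chain[OF dt h])
  show "(\<lambda>x. h (transition c d x)) differentiable (at x)"
    using differentiable_chain_at[OF dt h] by (simp add: o_def)
qed

lemma function_transform:
  assumes "c \<in> \<A>" "d \<in> \<A>" "x \<in> overlap c d" and u: "Ck_function \<A> 2 u"
  shows "pd i (u \<circ> chart_inv c) x = (\<Sum>a\<in>UNIV. pd a (u \<circ> chart_inv d) (transition c d x) * jac c d a i x)"
proof -
  have "(u \<circ> chart_inv d) differentiable (at (transition c d x))"
    using Ck_on_2D(1) u assms overlap_facts(3)[OF assms(1-3)] unfolding Ck_function_def by blast
  note * = pd_chart(1)[OF assms(1-3) this, of i]
  have "pd i (u \<circ> chart_inv c) x = pd i (\<lambda>x. (u \<circ> chart_inv d) (transition c d x)) x"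
    by (rule pd_cong[OF overlap_facts(1)[OF assms(1,2)] assms(3)])
      (simp add: overlap_facts(5)[OF assms(1,2)])
  then show ?thesis using * by simp
qed

lemma function_transform2:
  assumes "c \<in> \<A>" "d \<in> \<A>" "x \<in> overlap c d" and u: "Ck_function \<A> 2 u"
  shows "pd i (pd j (u \<circ> chart_inv c)) x
    = (\<Sum>a\<in>UNIV. \<Sum>b\<in>UNIV. jac c d a i x * jac c d b j x * pd a (pd b (u \<circ> chart_inv d)) (transition c d x))
      + (\<Sum>a\<in>UNIV. pd a (u \<circ> chart_inv d) (transition c d x) * pd i (jac c d a j) x)"
proof -
  let ?v = "u \<circ> chart_inv d"
  let ?y = "transition c d x"
  have v: "Ck_on 2 (coords d) ?v" using u assms unfolding Ck_function_def by blast
  have y: "?y \<in> coords d" by (rule overlap_facts(3)[OF assms(1-3)])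
  have dv: "pd b ?v differentiable (at ?y)" for b by (rule Ck_on_2_pd(1)[OF v y])
  have dJ: "jac c d b j differentiable (at x)" for b
    unfolding jac_def by (rule Ck_on_2_pd(1)[OF overlap_facts(8)[OF assms(1,2)] assms(3)])
  have "pd i (pd j (u \<circ> chart_inv c)) x
      = pd i (\<lambda>x. \<Sum>b\<in>UNIV. pd b ?v (transition c d x) * jac c d b j x) x"
    by (rule pd_cong[OF overlap_facts(1)[OF assms(1,2)] assms(3)])
      (rule function_transform[OF assms(1,2) _ u])
  also have "\<dots> = (\<Sum>b\<in>UNIV. pd i (\<lambda>x. pd b ?v (transition c d x)) x * jac c d b j x
      + pd b ?v ?y * pd i (jac c d b j) x)"
    by (rule pd_sum_mult) (auto intro!: pd_chart(2)[OF assms(1-3)] dv dJ)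
  also have "\<dots> = (\<Sum>b\<in>UNIV. \<Sum>a\<in>UNIV. jac c d a i x * jac c d b j x * pd a (pd b ?v) ?y)
      + (\<Sum>b\<in>UNIV. pd b ?v ?y * pd i (jac c d b j) x)"
    by (simp add: pd_chart(1)[OF assms(1-3) dv] sum.distrib sum_distrib_right sum_distrib_left mult_ac)
  finally show ?thesis by (subst (asm) sum.swap) simp
qed

lemma metric_transform_pd:
  assumes "c \<in> \<A>" "d \<in> \<A>" "x \<in> overlap c d"
  shows "pd l (metric_entry c i j) x
    = (\<Sum>a\<in>UNIV. \<Sum>b\<in>UNIV.
       (pd l (jac c d a i) x * jac c d b j x + jac c d a i x * pd l (jac c d b j) x) * metric_entry d a b (transition c d x)
       + jac c d a i x * jac c d b j x
         * (\<Sum>e\<in>UNIV. pd e (metric_entry d a b) (transition c d x) * jac c d e l x))"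
proof -
  have tf: "tensor_field \<A> g" using metric by (simp add: riemannian_metric_def symmetric_tensor_def)
  let ?y = "transition c d x"
  have y: "?y \<in> coords d" by (rule overlap_facts(3)[OF assms(1-3)])
  have dJ: "jac c d b j differentiable (at x)" for b j
    unfolding jac_def by (rule Ck_on_2_pd(1)[OF overlap_facts(8)[OF assms(1,2)] assms(3)])
  have dH: "metric_entry d a b differentiable (at ?y)" for a b
    by (rule Ck_on_2D(1)[OF metric_entry_C2[OF assms(2)] y])
  have dJJ: "(\<lambda>x. jac c d a i x * jac c d b j x) differentiable (at x)"
    "pd l (\<lambda>x. jac c d a i x * jac c d b j x) x
      = pd l (jac c d a i) x * jac c d b j x + jac c d a i x * pd l (jac c d b j) x" for a b
    using pd_sum_mult(1)[of "{()}" "\<lambda>_. jac c d a i" x "\<lambda>_. jac c d b j" l]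
      pd_sum_mult(2)[of "{()}" "\<lambda>_. jac c d a i" x "\<lambda>_. jac c d b j"] dJ by simp_all
  have "pd l (metric_entry c i j) x = pd l (\<lambda>x. \<Sum>ab\<in>UNIV \<times> UNIV.
      (jac c d (fst ab) i x * jac c d (snd ab) j x) * metric_entry d (fst ab) (snd ab) (transition c d x)) x"
  proof (rule pd_cong[OF overlap_facts(1)[OF assms(1,2)] assms(3)])
    fix z assume z: "z \<in> overlap c d"
    then have p: "chart_inv c z \<in> fst c \<inter> fst d" "snd c (chart_inv c z) = z"
      "chart_inv d (transition c d z) = chart_inv c z"
      using overlap_facts[OF assms(1,2)] assms by auto
    show "metric_entry c i j z = (\<Sum>ab\<in>UNIV \<times> UNIV.
      (jac c d (fst ab) i z * jac c d (snd ab) j z) * metric_entry d (fst ab) (snd ab) (transition c d z))"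
      using tensor_transform[OF tf assms(1,2) p(1), of i j]
      by (simp add: metric_entry_def p sum.cartesian_product case_prod_beta)
  qed
  also have "\<dots> = (\<Sum>ab\<in>UNIV \<times> UNIV.
       pd l (\<lambda>x. jac c d (fst ab) i x * jac c d (snd ab) j x) x * metric_entry d (fst ab) (snd ab) ?y
       + (jac c d (fst ab) i x * jac c d (snd ab) j x)
         * pd l (\<lambda>x. metric_entry d (fst ab) (snd ab) (transition c d x)) x)"
    by (rule pd_sum_mult) (auto intro!: pd_chart(2)[OF assms(1-3)] dH dJJ)
  also have "\<dots> = (\<Sum>a\<in>UNIV. \<Sum>b\<in>UNIV.
       (pd l (jac c d a i) x * jac c d b j x + jac c d a i x * pd l (jac c d b j) x) * metric_entry d a b ?y
       + jac c d a i x * jac c d b j x * (\<Sum>e\<in>UNIV. pd e (metric_entry d a b) ?y * jac c d e l x))"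
    by (simp add: dJJ pd_chart(1)[OF assms(1-3) dH] sum.cartesian_product case_prod_beta)
  finally show ?thesis .
qed

end

section \<open>Transformation of the Christoffel symbols\<close>

lemma matrix_inv_congruence:
  fixes g J :: "real ^ 'n ^ 'n"
  assumes "det g \<noteq> 0" "det J \<noteq> 0"
  shows "J ** matrix_inv (transpose J ** g ** J) ** transpose J = matrix_inv g"
proof -
  let ?G = "transpose J ** g ** J"
  have "det ?G \<noteq> 0" using assms by (simp add: det_mul)
  then have "transpose J ** (g ** (J ** matrix_inv ?G ** transpose J)) = transpose J"
    using matrix_inv_works(1)[of ?G] by (simp add: matrix_mul_assoc)
  moreover have "matrix_inv (transpose J) ** transpose J = mat 1"
    using assms by (intro matrix_inv_works) simp
  ultimately have "g ** (J ** matrix_inv ?G ** transpose J) = mat 1"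
    by (metis matrix_mul_assoc matrix_mul_lid)
  then show ?thesis by (rule matrix_inv_unique[symmetric])
qed

lemma eigenvalues_of_congruence:
  fixes g A J :: "real ^ 'n ^ 'n"
  assumes "det g \<noteq> 0" "det J \<noteq> 0"
  shows "eigenvalues_of (matrix_inv (transpose J ** g ** J) ** (transpose J ** A ** J))
    = eigenvalues_of (matrix_inv g ** A)"
proof -
  have "(matrix_inv g ** A) ** J = J ** (matrix_inv (transpose J ** g ** J) ** (transpose J ** A ** J))"
    by (simp add: matrix_mul_assoc flip: matrix_inv_congruence[OF assms])
  from eigenvalues_of_similar[OF this assms(2)] show ?thesis by simp
qed

lemma sum_rotate3:
  "(\<Sum>a\<in>A. \<Sum>b\<in>B. \<Sum>c\<in>C. F c a b) = (\<Sum>c\<in>C. \<Sum>a\<in>A. \<Sum>b\<in>B. F c a b)"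
  for F :: "'c \<Rightarrow> 'a \<Rightarrow> 'b \<Rightarrow> real"
proof -
  have "(\<Sum>a\<in>A. \<Sum>b\<in>B. \<Sum>c\<in>C. F c a b) = (\<Sum>a\<in>A. \<Sum>c\<in>C. \<Sum>b\<in>B. F c a b)"
    by (intro sum.cong refl sum.swap)
  also have "\<dots> = (\<Sum>c\<in>C. \<Sum>a\<in>A. \<Sum>b\<in>B. F c a b)" by (rule sum.swap)
  finally show ?thesis .
qed

text \<open>The index computation behind the transformation law, with \<open>J\<close> the Jacobian of the transition map,
  \<open>K\<close> its second derivatives, \<open>h\<close> the metric and \<open>D\<close> its derivatives in the new chart, \<open>E\<close> the
  derivatives of the metric in the old chart, and \<open>z\<close>, \<open>w\<close> the components of one vector in the old
  and the new chart. Of the six terms with second derivatives of the transition map, two agree and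
  the other four cancel by the symmetry of \<open>h\<close> and \<open>K\<close>.\<close>

lemma christoffel_transformation_algebra:
  fixes J h :: "'n::finite \<Rightarrow> 'n \<Rightarrow> real" and K D E :: "'n \<Rightarrow> 'n \<Rightarrow> 'n \<Rightarrow> real" and z w :: "'n \<Rightarrow> real"
  assumes hsym: "\<And>a b. h a b = h b a" and Ksym: "\<And>a i j. K a i j = K a j i"
    and E: "\<And>l i j. E l i j = (\<Sum>a\<in>UNIV. \<Sum>b\<in>UNIV.
        (K a l i * J b j + J a i * K b l j) * h a b + J a i * J b j * (\<Sum>e\<in>UNIV. D e a b * J e l))"
    and w: "\<And>b. w b = (\<Sum>l\<in>UNIV. J b l * z l)"
  shows "(\<Sum>l\<in>UNIV. z l * (E i j l + E j i l - E l i j))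
    = 2 * (\<Sum>a\<in>UNIV. K a i j * (\<Sum>b\<in>UNIV. h a b * w b))
      + (\<Sum>a\<in>UNIV. \<Sum>b\<in>UNIV. J a i * J b j * (\<Sum>e\<in>UNIV. w e * (D a b e + D b a e - D e a b)))"
proof -
  define U where "U = (\<lambda>a i. \<Sum>l\<in>UNIV. z l * K a i l)"
  have pull: "(\<Sum>l\<in>UNIV. z l * (\<Sum>a\<in>UNIV. \<Sum>b\<in>UNIV. F l a b)) = (\<Sum>a\<in>UNIV. \<Sum>b\<in>UNIV. \<Sum>l\<in>UNIV. z l * F l a b)"
    for F :: "'n \<Rightarrow> 'n \<Rightarrow> 'n \<Rightarrow> real"
    by (simp add: sum_distrib_left sum_rotate3[where F = "\<lambda>l a b. z l * F l a b"])
  have S1: "(\<Sum>l\<in>UNIV. z l * E i j l) = (\<Sum>a\<in>UNIV. \<Sum>b\<in>UNIV.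
      (K a i j * w b + J a j * U b i) * h a b + J a j * w b * (\<Sum>e\<in>UNIV. D e a b * J e i))" for i j
  proof -
    have "(\<Sum>l\<in>UNIV. z l * ((K a i j * J b l + J a j * K b i l) * h a b + J a j * J b l * X))
       = (K a i j * w b + J a j * U b i) * h a b + J a j * w b * X" for a b X
      by (simp add: w U_def distrib_left distrib_right sum.distrib sum_distrib_left sum_distrib_right mult_ac)
    then show ?thesis unfolding E pull by simp
  qed
  have S3: "(\<Sum>l\<in>UNIV. z l * E l i j) = (\<Sum>a\<in>UNIV. \<Sum>b\<in>UNIV.
      (U a i * J b j + J a i * U b j) * h a b + J a i * J b j * (\<Sum>e\<in>UNIV. D e a b * w e))"
  proof -
    have "(\<Sum>l\<in>UNIV. z l * (J a i * J b j * (\<Sum>e\<in>UNIV. D e a b * J e l)))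
      = J a i * J b j * (\<Sum>e\<in>UNIV. D e a b * w e)" for a b
    proof -
      have "(\<Sum>l\<in>UNIV. z l * (J a i * J b j * (\<Sum>e\<in>UNIV. D e a b * J e l)))
        = (\<Sum>l\<in>UNIV. \<Sum>e\<in>UNIV. J a i * J b j * (D e a b * (J e l * z l)))"
        by (simp add: sum_distrib_left mult_ac)
      also have "\<dots> = (\<Sum>e\<in>UNIV. \<Sum>l\<in>UNIV. J a i * J b j * (D e a b * (J e l * z l)))" by (rule sum.swap)
      finally show ?thesis by (simp add: w sum_distrib_left)
    qed
    moreover have "(\<Sum>l\<in>UNIV. z l * ((K a l i * J b j + J a i * K b l j) * h a b))
      = (U a i * J b j + J a i * U b j) * h a b" for a b
      by (simp add: U_def Ksym[of _ _ i] Ksym[of _ _ j] distrib_left distrib_right sum.distrib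
          sum_distrib_left sum_distrib_right mult_ac)
    ultimately show ?thesis unfolding E pull by (simp add: distrib_left sum.distrib)
  qed
  have Uswap: "(\<Sum>a\<in>UNIV. \<Sum>b\<in>UNIV. J a j * U b i * h a b) = (\<Sum>a\<in>UNIV. \<Sum>b\<in>UNIV. U a i * J b j * h a b)"
    by (subst sum.swap) (simp add: hsym[of _ "_ :: 'n"] mult_ac)
  have D1: "(\<Sum>a\<in>UNIV. \<Sum>b\<in>UNIV. J a j * w b * (\<Sum>e\<in>UNIV. D e a b * J e i))
    = (\<Sum>a\<in>UNIV. \<Sum>b\<in>UNIV. J a i * J b j * (\<Sum>e\<in>UNIV. w e * D a b e))"
  proof -
    have "(\<Sum>a\<in>UNIV. \<Sum>b\<in>UNIV. J a j * w b * (\<Sum>e\<in>UNIV. D e a b * J e i))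
      = (\<Sum>a\<in>UNIV. \<Sum>b\<in>UNIV. \<Sum>e\<in>UNIV. J e i * J a j * (w b * D e a b))"
      by (simp add: sum_distrib_left mult_ac)
    also have "\<dots> = (\<Sum>e\<in>UNIV. \<Sum>a\<in>UNIV. \<Sum>b\<in>UNIV. J e i * J a j * (w b * D e a b))"
      by (rule sum_rotate3)
    finally show ?thesis by (simp add: sum_distrib_left)
  qed
  have D2: "(\<Sum>a\<in>UNIV. \<Sum>b\<in>UNIV. J a i * w b * (\<Sum>e\<in>UNIV. D e a b * J e j))
    = (\<Sum>a\<in>UNIV. \<Sum>b\<in>UNIV. J a i * J b j * (\<Sum>e\<in>UNIV. w e * D b a e))"
  proof (rule sum.cong[OF refl])
    fix a
    have "(\<Sum>b\<in>UNIV. J a i * w b * (\<Sum>e\<in>UNIV. D e a b * J e j))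
      = (\<Sum>b\<in>UNIV. \<Sum>e\<in>UNIV. J a i * J e j * (w b * D e a b))"
      by (simp add: sum_distrib_left mult_ac)
    also have "\<dots> = (\<Sum>e\<in>UNIV. \<Sum>b\<in>UNIV. J a i * J e j * (w b * D e a b))" by (rule sum.swap)
    finally show "(\<Sum>b\<in>UNIV. J a i * w b * (\<Sum>e\<in>UNIV. D e a b * J e j))
      = (\<Sum>b\<in>UNIV. J a i * J b j * (\<Sum>e\<in>UNIV. w e * D b a e))"
      by (simp add: sum_distrib_left)
  qed
  have "(\<Sum>l\<in>UNIV. z l * (E i j l + E j i l - E l i j))
    = (\<Sum>l\<in>UNIV. z l * E i j l) + (\<Sum>l\<in>UNIV. z l * E j i l) - (\<Sum>l\<in>UNIV. z l * E l i j)"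
    by (simp add: algebra_simps sum.distrib sum_subtractf)
  also have "\<dots> = 2 * (\<Sum>a\<in>UNIV. \<Sum>b\<in>UNIV. K a i j * w b * h a b)
      + ((\<Sum>a\<in>UNIV. \<Sum>b\<in>UNIV. J a j * U b i * h a b) - (\<Sum>a\<in>UNIV. \<Sum>b\<in>UNIV. U a i * J b j * h a b))
      + (\<Sum>a\<in>UNIV. \<Sum>b\<in>UNIV. J a j * w b * (\<Sum>e\<in>UNIV. D e a b * J e i))
      + (\<Sum>a\<in>UNIV. \<Sum>b\<in>UNIV. J a i * w b * (\<Sum>e\<in>UNIV. D e a b * J e j))
      - (\<Sum>a\<in>UNIV. \<Sum>b\<in>UNIV. J a i * J b j * (\<Sum>e\<in>UNIV. D e a b * w e))"
    unfolding S1 S3 by (simp add: distrib_right sum.distrib Ksym[of _ j i])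
  also have "\<dots> = 2 * (\<Sum>a\<in>UNIV. K a i j * (\<Sum>b\<in>UNIV. h a b * w b))
      + ((\<Sum>a\<in>UNIV. \<Sum>b\<in>UNIV. J a i * J b j * (\<Sum>e\<in>UNIV. w e * D a b e))
       + (\<Sum>a\<in>UNIV. \<Sum>b\<in>UNIV. J a i * J b j * (\<Sum>e\<in>UNIV. w e * D b a e))
       - (\<Sum>a\<in>UNIV. \<Sum>b\<in>UNIV. J a i * J b j * (\<Sum>e\<in>UNIV. D e a b * w e)))"
    unfolding Uswap D1 D2 by (simp add: sum_distrib_left mult_ac)
  also have "(\<Sum>a\<in>UNIV. \<Sum>b\<in>UNIV. J a i * J b j * (\<Sum>e\<in>UNIV. w e * D a b e))
       + (\<Sum>a\<in>UNIV. \<Sum>b\<in>UNIV. J a i * J b j * (\<Sum>e\<in>UNIV. w e * D b a e))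
       - (\<Sum>a\<in>UNIV. \<Sum>b\<in>UNIV. J a i * J b j * (\<Sum>e\<in>UNIV. D e a b * w e))
    = (\<Sum>a\<in>UNIV. \<Sum>b\<in>UNIV. J a i * J b j * (\<Sum>e\<in>UNIV. w e * (D a b e + D b a e - D e a b)))"
    by (simp add: distrib_left right_diff_distrib sum.distrib sum_subtractf mult.commute[of "w _" "D _ _ _"])
  finally show ?thesis .
qed

context riemannian_atlas
begin

definition jac_matrix :: "('a, 'n) chart \<Rightarrow> ('a, 'n) chart \<Rightarrow> 'a \<Rightarrow> real ^ 'n ^ 'n" where
  "jac_matrix c d p = (\<chi> a i. jac c d a i (snd c p))"

lemma tensor_field_iff:
  "tensor_field \<A> T \<longleftrightarrow> (\<forall>c\<in>\<A>. \<forall>d\<in>\<A>. \<forall>p\<in>fst c \<inter> fst d.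
     T c p = transpose (jac_matrix c d p) ** T d p ** jac_matrix c d p)"
proof -
  have "jacobian (snd d \<circ> chart_inv c) (at (snd c p)) = jac_matrix c d p"
    if "c \<in> \<A>" "d \<in> \<A>" "p \<in> fst c \<inter> fst d" for c d p
    using jacobian_eq[OF that(1,2), of "snd c p"] that(3) by (simp add: jac_matrix_def)
  note eq = this
  show ?thesis
    unfolding tensor_field_def Let_def by (intro ball_cong refl) (simp add: eq)
qed

lemma tensor_fieldD:
  assumes "tensor_field \<A> T" "c \<in> \<A>" "d \<in> \<A>" "p \<in> fst c \<inter> fst d"
  shows "T c p = transpose (jac_matrix c d p) ** T d p ** jac_matrix c d p"
  using assms unfolding tensor_field_iff by blast

lemma metric_tensor_field: "tensor_field \<A> g"
  using metric by (simp add: riemannian_metric_def symmetric_tensor_def)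

lemma det_jac_matrix:
  assumes "c \<in> \<A>" "d \<in> \<A>" "p \<in> fst c \<inter> fst d"
  shows "det (jac_matrix c d p) \<noteq> 0"
proof -
  have "g c p = transpose (jac_matrix c d p) ** g d p ** jac_matrix c d p"
    by (rule tensor_fieldD[OF metric_tensor_field assms])
  moreover have "det (g c p) \<noteq> 0" using metric_pos_def assms pos_def_det by blast
  ultimately show ?thesis by (auto simp: det_mul)
qed

lemma tensor_eigenvalues_chart_independent:
  assumes "tensor_field \<A> T" "c \<in> \<A>" "d \<in> \<A>" "p \<in> fst c \<inter> fst d"
  shows "tensor_eigenvalues g T c p = tensor_eigenvalues g T d p"
proof -
  let ?J = "jac_matrix c d p"
  have "det (g d p) \<noteq> 0" using metric_pos_def assms pos_def_det by blast
  from eigenvalues_of_congruence[OF this det_jac_matrix[OF assms(2-4)], of "T d p"]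
  show ?thesis
    unfolding tensor_eigenvalues_def raise_index_def
      tensor_fieldD[OF metric_tensor_field assms(2-4)] tensor_fieldD[OF assms] .
qed

lemma metric_gradient:
  assumes "c \<in> \<A>" "p \<in> fst c"
  shows "g c p *v gradient g u c p = differential u c p"
  using matrix_inv_works(1)[OF pos_def_det[OF metric_pos_def[OF assms]]]
  by (simp add: gradient_def matrix_vector_mul_assoc)

lemma differential_transform:
  assumes "c \<in> \<A>" "d \<in> \<A>" "p \<in> fst c \<inter> fst d" "Ck_function \<A> 2 u"
  shows "differential u c p = transpose (jac_matrix c d p) *v differential u d p"
proof -
  have x: "snd c p \<in> overlap c d" using assms(3) by blast
  show ?thesis
    by (simp add: vec_eq_iff differential_def jac_matrix_def matrix_vector_mult_def transpose_def
        mult.commute function_transform[OF assms(1,2) x assms(4)] overlap_facts(6)[OF assms(1-3)]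
        del: transpose_matrix_vector)
qed

lemma gradient_transform:
  assumes "c \<in> \<A>" "d \<in> \<A>" "p \<in> fst c \<inter> fst d" "Ck_function \<A> 2 u"
  shows "gradient g u d p = jac_matrix c d p *v gradient g u c p"
proof -
  let ?J = "jac_matrix c d p"
  have "det (g d p) \<noteq> 0" using metric_pos_def assms pos_def_det by blast
  from matrix_inv_congruence[OF this det_jac_matrix[OF assms(1-3)]]
  have "matrix_inv (g d p) = ?J ** matrix_inv (g c p) ** transpose ?J"
    unfolding tensor_fieldD[OF metric_tensor_field assms(1-3)] by (rule sym)
  then show ?thesis
    by (simp add: gradient_def differential_transform[OF assms] matrix_vector_mul_assoc matrix_mul_assoc
        del: transpose_matrix_vector)
qed

text \<open>The inhomogeneous term is exactly the one by which the second partial derivatives of \<open>u\<close> fail to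
  be a tensor.\<close>

lemma christoffel_du_transform:
  assumes "c \<in> \<A>" "d \<in> \<A>" "p \<in> fst c \<inter> fst d" and u: "Ck_function \<A> 2 u"
  shows "christoffel_du u c p i j
    = (\<Sum>a\<in>UNIV. pd i (jac c d a j) (snd c p) * differential u d p $ a)
      + (\<Sum>a\<in>UNIV. \<Sum>b\<in>UNIV. jac c d a i (snd c p) * jac c d b j (snd c p) * christoffel_du u d p a b)"
proof -
  let ?x = "snd c p"
  have x: "?x \<in> overlap c d" and pc: "p \<in> fst c" and pd: "p \<in> fst d" using assms by auto
  have y: "transition c d ?x = snd d p" by (rule overlap_facts(6)[OF assms(1-3)])
  define J where "J = (\<lambda>a i. jac c d a i ?x)"
  define K where "K = (\<lambda>a i j. pd i (jac c d a j) ?x)"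
  define h where "h = (\<lambda>a b. g d p $ a $ b)"
  define D where "D = metric_pd g d p"
  define E where "E = metric_pd g c p"
  define z where "z = (\<lambda>l. gradient g u c p $ l)"
  define w where "w = (\<lambda>l. gradient g u d p $ l)"
  have hsym: "h a b = h b a" for a b using metric_sym[OF assms(2) pd] by (simp add: h_def)
  have Ksym: "K a i j = K a j i" for a i j
    unfolding K_def jac_def
    by (rule pd_commute[OF overlap_facts(8)[OF assms(1,2)] overlap_facts(1)[OF assms(1,2)] x])
  have E: "E l i j = (\<Sum>a\<in>UNIV. \<Sum>b\<in>UNIV.
        (K a l i * J b j + J a i * K b l j) * h a b + J a i * J b j * (\<Sum>e\<in>UNIV. D e a b * J e l))" for l i j
    using metric_transform_pd[OF assms(1,2) x, of l i j] chart_inv_left[OF assms(2) pd]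
    by (simp add: E_def K_def J_def h_def D_def metric_pd_eq y) (simp add: metric_entry_def)
  have w: "w b = (\<Sum>l\<in>UNIV. J b l * z l)" for b
    using gradient_transform[OF assms(1-3) u]
    by (simp add: w_def z_def J_def jac_matrix_def matrix_vector_mult_def)
  have dv: "(\<Sum>b\<in>UNIV. h a b * w b) = differential u d p $ a" for a
    using arg_cong[OF metric_gradient[OF assms(2) pd, of u], of "\<lambda>v. v $ a"]
    by (simp add: h_def w_def matrix_vector_mult_def)
  have "christoffel_du u c p i j = (1/2) * (\<Sum>l\<in>UNIV. z l * (E i j l + E j i l - E l i j))"
    by (simp add: christoffel_contract[OF assms(1) pc] z_def E_def)
  also have "\<dots> = (\<Sum>a\<in>UNIV. K a i j * differential u d p $ a)
    + (\<Sum>a\<in>UNIV. \<Sum>b\<in>UNIV. J a i * J b j * ((1/2) * (\<Sum>e\<in>UNIV. w e * (D a b e + D b a e - D e a b))))"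
    unfolding christoffel_transformation_algebra[of h K E J D w z, OF hsym Ksym E w] dv
    by (simp add: distrib_left sum_distrib_left mult_ac)
  finally show ?thesis
    by (simp add: K_def J_def christoffel_contract[OF assms(2) pd] w_def D_def)
qed

section \<open>Tensoriality of the equation\<close>

lemma hessian_entry:
  "hessian g u c p $ i $ j = pd i (pd j (u \<circ> chart_inv c)) (snd c p) - christoffel_du u c p i j"
  by (simp add: hessian_def christoffel_du_def)

lemma hessian_tensor_field:
  assumes u: "Ck_function \<A> 2 u"
  shows "tensor_field \<A> (hessian g u)"
  unfolding tensor_field_iff
proof (intro ballI)
  fix c d p assume cd: "c \<in> \<A>" "d \<in> \<A>" "p \<in> fst c \<inter> fst d"
  let ?x = "snd c p"
  have x: "?x \<in> overlap c d" using cd by auto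
  have y: "transition c d ?x = snd d p" by (rule overlap_facts(6)[OF cd])
  have "hessian g u c p $ i $ j = (\<Sum>a\<in>UNIV. \<Sum>b\<in>UNIV. jac c d a i ?x * jac c d b j ?x * hessian g u d p $ a $ b)" for i j
    using function_transform2[OF cd(1,2) x u, of i j] christoffel_du_transform[OF cd u, of i j]
    by (simp add: hessian_entry y right_diff_distrib sum_subtractf differential_def mult.commute)
  then show "hessian g u c p = transpose (jac_matrix c d p) ** hessian g u d p ** jac_matrix c d p"
    by (simp add: vec_eq_iff congruence_entry jac_matrix_def)
qed

lemma equation_tensor_field:
  assumes u: "Ck_function \<A> 2 u" and S: "tensor_field \<A> S"
  shows "tensor_field \<A> (equation_tensor g S u)"
  unfolding tensor_field_iff
proof (intro ballI)
  fix c d p assume cd: "c \<in> \<A>" "d \<in> \<A>" "p \<in> fst c \<inter> fst d"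
  let ?J = "jac_matrix c d p"
  have outer: "du_otimes_du u c' p = outer (differential u c' p) (differential u c' p)" for c' :: "('a, 'n) chart"
    by (simp add: du_otimes_du_def outer_def)
  have du: "du_otimes_du u c p = transpose ?J ** du_otimes_du u d p ** ?J"
    unfolding outer differential_transform[OF cd u]
    using matrix_outer_mult[of "transpose ?J" _ _ "transpose ?J"] by simp
  have "grad_norm_sq g u c p = grad_norm_sq g u d p"
  proof -
    have "grad_norm_sq g u c p = gradient g u c p \<bullet> (transpose ?J *v differential u d p)"
      using cd by (simp add: grad_norm_sq_def metric_gradient differential_transform[OF cd u])
    also have "\<dots> = (?J *v gradient g u c p) \<bullet> differential u d p"
      by (metis dot_lmul_matrix inner_commute vector_transpose_matrix transpose_transpose)
    also have "\<dots> = grad_norm_sq g u d p"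
      using cd by (simp add: grad_norm_sq_def metric_gradient flip: gradient_transform[OF cd u])
    finally show ?thesis .
  qed
  then show "equation_tensor g S u c p = transpose ?J ** equation_tensor g S u d p ** ?J"
    unfolding equation_tensor_def du tensor_fieldD[OF hessian_tensor_field[OF u] cd]
      tensor_fieldD[OF S cd] tensor_fieldD[OF metric_tensor_field cd]
    by (simp add: matrix_add_ldistrib matrix_mult_distrib_right matrix_diff_distrib matrix_scaleR_mult)
qed

lemma hessian_symmetric:
  assumes u: "Ck_function \<A> 2 u" and c: "c \<in> \<A>" "p \<in> fst c"
  shows "hessian g u c p $ i $ j = hessian g u c p $ j $ i"
proof -
  have "pd i (pd j (u \<circ> chart_inv c)) (snd c p) = pd j (pd i (u \<circ> chart_inv c)) (snd c p)"
    using u c by (intro pd_commute[OF _ chart(2)]) (auto simp: Ck_function_def)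
  moreover have "christoffel g c p m i j = christoffel g c p m j i" for m
    unfolding christoffel_def by (simp add: metric_pd_sym[OF c, of _ i j] add.commute)
  ultimately show ?thesis by (simp add: hessian_def)
qed

lemma symmetric_equation_tensor:
  assumes u: "Ck_function \<A> 2 u" and S: "symmetric_tensor \<A> S"
  shows "symmetric_tensor \<A> (equation_tensor g S u)"
proof -
  have "transpose (equation_tensor g S u c p) = equation_tensor g S u c p" if c: "c \<in> \<A>" "p \<in> fst c" for c p
  proof -
    have "transpose (S c p) = S c p" using S c by (simp add: symmetric_tensor_def)
    from arg_cong[OF this, of "\<lambda>M. M $ i $ j" for i j]
    have "S c p $ j $ i = S c p $ i $ j" for i j by (simp add: transpose_def)
    then show ?thesis
      using hessian_symmetric[OF u c] metric_sym[OF c]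
      by (simp add: vec_eq_iff transpose_def equation_tensor_def du_otimes_du_def mult.commute)
  qed
  then show ?thesis using equation_tensor_field[OF u] S by (simp add: symmetric_tensor_def)
qed

lemma continuous_on_chart_inv:
  assumes "c \<in> \<A>" "continuous_on (coords c) (\<lambda>x. h (chart_inv c x))"
  shows "continuous_on (fst c) h"
  using continuous_on_chart[OF assms] assms(1) by (simp cong: continuous_on_cong)

lemma continuous_on_entries:
  assumes "c \<in> \<A>" "Ck_tensor \<A> 0 T"
  shows "continuous_on (fst c) (\<lambda>p. T c p $ i $ j)"
  using assms by (intro continuous_on_chart_inv) (auto simp: Ck_tensor_def intro!: continuous_intros)

lemma continuous_on_metric:
  "c \<in> \<A> \<Longrightarrow> continuous_on (fst c) (\<lambda>p. g c p $ i $ j)"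
  using metric by (intro continuous_on_entries) (simp add: riemannian_metric_def)+

lemma continuous_on_equation_tensor:
  assumes u: "Ck_function \<A> 2 u" and S: "Ck_tensor \<A> 0 S" and c: "c \<in> \<A>"
  shows "continuous_on (fst c) (\<lambda>p. equation_tensor g S u c p $ i $ j)"
proof -
  have v: "Ck_on 2 (coords c) (u \<circ> chart_inv c)" using u c by (simp add: Ck_function_def)
  have dd: "continuous_on (fst c) (\<lambda>p. pd i (pd j (u \<circ> chart_inv c)) (snd c p))" for i j
    by (rule continuous_on_chart[OF c Ck_on_2_pd(3)[OF v]])
  have d: "continuous_on (fst c) (\<lambda>p. differential u c p $ i)" for i
    using continuous_on_chart[OF c Ck_on_2_pd(2)[OF v]] by (simp add: differential_def)
  have dg: "continuous_on (fst c) (\<lambda>p. metric_pd g c p l i j)" for l i j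
    unfolding metric_pd_eq by (rule continuous_on_chart[OF c Ck_on_2_pd(2)[OF metric_entry_C2[OF c]]])
  have inv: "continuous_on (fst c) (\<lambda>p. matrix_inv (g c p) $ i $ j)" for i j
    using continuous_on_metric[OF c] pos_def_det[OF metric_pos_def[OF c]]
    by (intro continuous_on_matrix_inv) auto
  have gr: "continuous_on (fst c) (\<lambda>p. gradient g u c p $ i)" for i
    by (simp add: gradient_def matrix_vector_mult_def) (intro continuous_intros inv d)
  have ch: "continuous_on (fst c) (\<lambda>p. christoffel_du u c p i j)" for i j
    unfolding christoffel_du_def christoffel_def
    by (intro continuous_on_sum continuous_on_mult continuous_on_add continuous_on_diff
        continuous_on_const inv d dg)
  have gn: "continuous_on (fst c) (\<lambda>p. grad_norm_sq g u c p)"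
    unfolding grad_norm_sq_def inner_vec_def matrix_vector_mult_def inner_real_def vec_lambda_beta
    by (intro continuous_on_sum continuous_on_mult gr continuous_on_metric[OF c])
  have "equation_tensor g S u c p $ i $ j
    = pd i (pd j (u \<circ> chart_inv c)) (snd c p) - christoffel_du u c p i j
      - differential u c p $ i * differential u c p $ j
      + (1/2) * grad_norm_sq g u c p * g c p $ i $ j + S c p $ i $ j" for p
    by (simp add: equation_tensor_def hessian_entry du_otimes_du_def)
  moreover have "continuous_on (fst c) (\<lambda>p. pd i (pd j (u \<circ> chart_inv c)) (snd c p) - christoffel_du u c p i j
      - differential u c p $ i * differential u c p $ j
      + (1/2) * grad_norm_sq g u c p * g c p $ i $ j + S c p $ i $ j)"
    by (intro continuous_on_mult continuous_on_add continuous_on_diff continuous_on_const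
        d dd ch gn continuous_on_metric[OF c] continuous_on_entries[OF c S])
  ultimately show ?thesis by simp
qed

end

section \<open>The maximum principle\<close>

lemma local_max_second_derivative:
  fixes h :: "real ^ 'n \<Rightarrow> real"
  assumes h: "Ck_on 2 X h" and "open X" "x \<in> X" and max: "\<And>y. y \<in> X \<Longrightarrow> h y \<le> h x"
  shows "pd i h x = 0" and "v \<bullet> ((\<chi> i j. pd i (pd j h) x) *v v) \<le> 0"
proof -
  let ?h = "\<lambda>y. - h y"
  have nh: "Ck_on 2 X ?h"
    by (rule Ck_on_bounded_linear[OF \<open>open X\<close> bounded_linear_minus[OF bounded_linear_ident] h])
  have neg: "pd i (\<lambda>y. - f y) y = - pd i f y" if "f differentiable (at y)" for f :: "real ^ 'n \<Rightarrow> real" and i y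
    using pd_eqI[OF has_derivative_minus[OF that[unfolded frechet_derivative_works]]] by (simp add: pd_def)
  have 1: "pd i ?h y = - pd i h y" if "y \<in> X" for i y
    using Ck_on_2D(1)[OF h that] by (rule neg)
  have 2: "pd i (pd j ?h) x = - pd i (pd j h) x" for i j
    using pd_cong[OF \<open>open X\<close> \<open>x \<in> X\<close>, of "pd j ?h" "\<lambda>y. - pd j h y"] 1
      neg[OF Ck_on_2_pd(1)[OF h \<open>x \<in> X\<close>]] by simp
  have m: "?h x \<le> ?h y" if "y \<in> X" for y using max[OF that] by simp
  show "pd i h x = 0"
    using local_min_second_derivative(1)[OF nh \<open>open X\<close> \<open>x \<in> X\<close> m] 1[OF \<open>x \<in> X\<close>] by simp
  have "0 \<le> v \<bullet> ((\<chi> i j. - pd i (pd j h) x) *v v)"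
    using local_min_second_derivative(2)[OF nh \<open>open X\<close> \<open>x \<in> X\<close> m, of v] unfolding 2 by simp
  then show "v \<bullet> ((\<chi> i j. pd i (pd j h) x) *v v) \<le> 0"
    by (simp add: inner_vec_def matrix_vector_mult_def sum_negf)
qed

context riemannian_atlas
begin

lemma equation_tensor_critical:
  assumes "c \<in> \<A>" "p \<in> fst c" and crit: "\<And>i. pd i (u \<circ> chart_inv c) (snd c p) = 0"
  shows "equation_tensor g S u c p = S c p + (\<chi> i j. pd i (pd j (u \<circ> chart_inv c)) (snd c p))"
proof -
  have "differential u c p = 0" by (simp add: differential_def vec_eq_iff crit)
  then have "grad_norm_sq g u c p = 0" "\<And>i. differential u c p $ i = 0"
    by (simp_all add: grad_norm_sq_def gradient_def)
  then show ?thesis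
    by (simp add: equation_tensor_def du_otimes_du_def hessian_def vec_eq_iff)
qed

lemma hessian_coords_symmetric:
  assumes u: "Ck_function \<A> 2 u" and c: "c \<in> \<A>" "p \<in> fst c"
  shows "transpose (\<chi> i j. pd i (pd j (u \<circ> chart_inv c)) (snd c p))
    = (\<chi> i j. pd i (pd j (u \<circ> chart_inv c)) (snd c p))"
proof -
  have "pd i (pd j (u \<circ> chart_inv c)) (snd c p) = pd j (pd i (u \<circ> chart_inv c)) (snd c p)" for i j
    using u c by (intro pd_commute[OF _ chart(2)]) (auto simp: Ck_function_def)
  then show ?thesis by (simp add: transpose_def vec_eq_iff)
qed

lemma Ck_function_2_local:
  assumes u: "Ck_function \<A> 2 u" and c: "c \<in> \<A>" and U: "U \<subseteq> fst c"
  shows "Ck_on 2 (snd c ` U) (u \<circ> chart_inv c)"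
proof -
  have sub: "snd c ` U \<subseteq> coords c" using U by auto
  have "Ck_on m X h \<Longrightarrow> Y \<subseteq> X \<Longrightarrow> Ck_on m Y h" for m X Y and h :: "real ^ 'n \<Rightarrow> real"
    by (induction m arbitrary: h) (auto intro: continuous_on_subset)
  then show ?thesis using u c sub by (auto simp: Ck_function_def)
qed

text \<open>At a critical point the gradient terms drop out, leaving \<open>S\<close> plus the matrix of second partial
  derivatives, which is nonnegative.\<close>

lemma admissible_at_local_min:
  assumes u: "Ck_function \<A> 2 u" and S: "symmetric_tensor \<A> S" and k: "k \<le> CARD('n)"
    and c: "c \<in> \<A>" "p \<in> fst c" and adm: "admissible k (g c p) (S c p)"
    and U: "open U" "p \<in> U" and min: "\<And>q. q \<in> U \<Longrightarrow> u p \<le> u q"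
  shows "admissible k (g c p) (equation_tensor g S u c p)
    \<and> sym_eig k (g c p) (S c p) \<le> sym_eig k (g c p) (equation_tensor g S u c p)"
proof -
  let ?X = "snd c ` (U \<inter> fst c)"
  let ?P = "\<chi> i j. pd i (pd j (u \<circ> chart_inv c)) (snd c p)"
  have X: "open ?X" using open_overlap[OF c(1), of "U \<inter> fst c"] U chart(1)[OF c(1)] by auto
  have x: "snd c p \<in> ?X" using U c by auto
  have C2: "Ck_on 2 ?X (u \<circ> chart_inv c)" using Ck_function_2_local[OF u c(1)] by simp
  have m: "(u \<circ> chart_inv c) (snd c p) \<le> (u \<circ> chart_inv c) y" if "y \<in> ?X" for y
    using that c min by auto
  note lm = local_min_second_derivative[where h = "u \<circ> chart_inv c", OF C2 X x m]
  have A: "equation_tensor g S u c p = S c p + ?P" by (rule equation_tensor_critical[OF c lm(1)])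
  have "transpose (S c p) = S c p" using S c by (simp add: symmetric_tensor_def)
  from admissible_add_nonneg[OF metric_pos_def[OF c] this k adm hessian_coords_symmetric[OF u c] lm(2)]
  show ?thesis unfolding A .
qed

text \<open>Here \<open>S\<close> is obtained from the tensor of the equation by adding a nonnegative matrix, so it is the
  latter that has to lie in the cone.\<close>

lemma sym_eig_le_at_local_max:
  assumes u: "Ck_function \<A> 2 u" and S: "symmetric_tensor \<A> S" and k: "k \<le> CARD('n)"
    and c: "c \<in> \<A>" "p \<in> fst c" and adm: "admissible k (g c p) (equation_tensor g S u c p)"
    and U: "open U" "p \<in> U" and max: "\<And>q. q \<in> U \<Longrightarrow> u q \<le> u p"
  shows "sym_eig k (g c p) (equation_tensor g S u c p) \<le> sym_eig k (g c p) (S c p)"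
proof -
  let ?X = "snd c ` (U \<inter> fst c)"
  let ?P = "\<chi> i j. pd i (pd j (u \<circ> chart_inv c)) (snd c p)"
  have X: "open ?X" using open_overlap[OF c(1), of "U \<inter> fst c"] U chart(1)[OF c(1)] by auto
  have x: "snd c p \<in> ?X" using U c by auto
  have C2: "Ck_on 2 ?X (u \<circ> chart_inv c)" using Ck_function_2_local[OF u c(1)] by simp
  have m: "(u \<circ> chart_inv c) y \<le> (u \<circ> chart_inv c) (snd c p)" if "y \<in> ?X" for y
    using that c max by auto
  note lm = local_max_second_derivative[where h = "u \<circ> chart_inv c", OF C2 X x m]
  have A: "equation_tensor g S u c p = S c p + ?P" by (rule equation_tensor_critical[OF c lm(1)])
  have tr: "transpose (- ?P) = - ?P"
  proof -
    have "transpose (- ?P) = - transpose ?P" by (simp add: transpose_def vec_eq_iff)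
    then show ?thesis by (simp only: hessian_coords_symmetric[OF u c])
  qed
  have nn: "0 \<le> v \<bullet> (- ?P *v v)" for v
  proof -
    have "- ?P *v v = - (?P *v v)" by (simp add: matrix_vector_mult_def vec_eq_iff sum_negf)
    then have "v \<bullet> (- ?P *v v) = - (v \<bullet> (?P *v v))" by (simp only: inner_minus_right)
    then show ?thesis using lm(2)[of v] by linarith
  qed
  have "transpose (equation_tensor g S u c p) = equation_tensor g S u c p"
    using symmetric_equation_tensor[OF u S] c by (simp add: symmetric_tensor_def)
  from admissible_add_nonneg[OF metric_pos_def[OF c] this k adm tr nn]
  show ?thesis by (simp add: A)
qed

definition chart_at :: "'a \<Rightarrow> ('a, 'n) chart" where
  "chart_at p = (SOME c. c \<in> \<A> \<and> p \<in> fst c)"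

lemma chart_at: "chart_at p \<in> \<A>" "p \<in> fst (chart_at p)"
proof -
  have "\<exists>c. c \<in> \<A> \<and> p \<in> fst c" using in_some_chart[of p] by blast
  from someI_ex[OF this] show "chart_at p \<in> \<A>" "p \<in> fst (chart_at p)" by (simp_all add: chart_at_def)
qed

text \<open>For tensor fields the choice of the chart does not matter, which makes this a function on the
  manifold.\<close>

definition tensor_sigma :: "('a, 'n) tensor02 \<Rightarrow> nat \<Rightarrow> 'a \<Rightarrow> real" where
  "tensor_sigma T j p = sigma_k j (tensor_eigenvalues g T (chart_at p) p)"

lemma tensor_sigma_eq:
  assumes "tensor_field \<A> T" "c \<in> \<A>" "p \<in> fst c"
  shows "tensor_sigma T j p = sym_eig j (g c p) (T c p)"
proof -
  have "tensor_eigenvalues g T (chart_at p) p = tensor_eigenvalues g T c p"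
    by (rule tensor_eigenvalues_chart_independent) (use assms chart_at in auto)
  then show ?thesis
    by (simp add: tensor_sigma_def sigma_k_eq_esym sym_eig_def tensor_eigenvalues_def raise_index_def)
qed

lemma continuous_from_charts:
  assumes "\<And>c. c \<in> \<A> \<Longrightarrow> continuous_on (fst c) h"
  shows "continuous_on UNIV h"
proof -
  have "continuous_on (\<Union>(fst ` \<A>)) h"
    by (rule continuous_on_open_Union) (use assms chart(1) in auto)
  moreover have "\<Union>(fst ` \<A>) = UNIV" using in_some_chart by auto
  ultimately show ?thesis by simp
qed

lemma continuous_tensor_sigma:
  assumes T: "symmetric_tensor \<A> T"
    and cont: "\<And>c i j. c \<in> \<A> \<Longrightarrow> continuous_on (fst c) (\<lambda>p. T c p $ i $ j)"
  shows "continuous_on UNIV (tensor_sigma T j)"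
proof (rule continuous_from_charts)
  fix c assume c: "c \<in> \<A>"
  have "continuous_on (fst c) (\<lambda>p. sym_eig j (g c p) (T c p))"
    using continuous_on_metric[OF c] cont[OF c] metric_pos_def[OF c] T c
    by (intro continuous_on_sym_eig) (auto simp: symmetric_tensor_def)
  then show "continuous_on (fst c) (tensor_sigma T j)"
    using tensor_sigma_eq[OF _ c] T by (simp add: symmetric_tensor_def cong: continuous_on_cong)
qed

lemma continuous_Ck_function:
  assumes "Ck_function \<A> m u" shows "continuous_on UNIV u"
proof (rule continuous_from_charts)
  fix c assume c: "c \<in> \<A>"
  have "continuous_on (coords c) (u \<circ> chart_inv c)"
  proof (cases m)
    case 0
    then show ?thesis using assms c by (simp add: Ck_function_def)
  next
    case (Suc m')
    then have "\<forall>x\<in>coords c. (u \<circ> chart_inv c) differentiable (at x)"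
      using assms c by (simp add: Ck_function_def)
    then show ?thesis
      by (intro continuous_at_imp_continuous_on ballI differentiable_imp_continuous_within) blast
  qed
  then show "continuous_on (fst c) u" using c by (intro continuous_on_chart_inv) (simp_all add: o_def)
qed

text \<open>Each point at which the tensor leaves the cone has a neighbourhood of such points, since some
  \<open>\<sigma>\<^sub>j\<close> is then negative and not merely zero. A minimum of \<open>u\<close> over the set of these
  points is therefore a local minimum of \<open>u\<close>, and there the tensor is in the cone.\<close>

lemma admissible_everywhere:
  assumes u: "Ck_function \<A> 2 u" and comp: "compact (UNIV :: 'a set)"
    and S: "symmetric_tensor \<A> S" "Ck_tensor \<A> 0 S" and k: "k \<le> CARD('n)"
    and adm: "\<And>c p. c \<in> \<A> \<Longrightarrow> p \<in> fst c \<Longrightarrow> admissible k (g c p) (S c p)"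
    and pos: "\<And>p. 0 < tensor_sigma (equation_tensor g S u) k p"
    and c: "c \<in> \<A>" "p \<in> fst c"
  shows "admissible k (g c p) (equation_tensor g S u c p)"
proof -
  let ?A = "equation_tensor g S u"
  have A: "symmetric_tensor \<A> ?A" by (rule symmetric_equation_tensor[OF u S(1)])
  then have tA: "tensor_field \<A> ?A" by (simp add: symmetric_tensor_def)
  have cont: "continuous_on UNIV (tensor_sigma ?A j)" for j
    by (rule continuous_tensor_sigma[OF A continuous_on_equation_tensor[OF u S(2)]])
  define V where "V = (\<Union>j\<in>{..k}. {p. tensor_sigma ?A j p < 0})"
  define W where "W = (\<Inter>j\<in>{..k}. {p. 0 < tensor_sigma ?A j p})"
  have op: "open V" "open W"
    unfolding V_def W_def
    by (intro open_UN open_INT ballI open_Collect_less cont continuous_on_const finite_atMost)+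
  have WV: "p \<in> W \<longleftrightarrow> p \<notin> V" for p
  proof
    assume "p \<notin> V"
    then have "admissible k (g (chart_at p) p) (?A (chart_at p) p)"
      using tensor_sigma_eq[OF tA chart_at(1)[of p] chart_at(2)[of p]] pos[of p]
      by (intro admissibleI[OF k]) (auto simp: V_def not_less)
    then show "p \<in> W" by (auto simp: W_def admissible_def tensor_sigma_eq[OF tA chart_at])
  qed (force simp: V_def W_def)
  have "V = - W" using WV by auto
  then have "closed V" using op by auto
  then have cV: "compact V" using comp compact_Int_closed[of UNIV V] by simp
  have "V = {}"
  proof (rule ccontr)
    assume "V \<noteq> {}"
    then obtain q where q: "q \<in> V" and min: "\<And>r. r \<in> V \<Longrightarrow> u q \<le> u r"
      using continuous_attains_inf[OF cV _ continuous_on_subset[OF continuous_Ck_function[OF u] subset_UNIV]]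
      by blast
    have "admissible k (g (chart_at q) q) (?A (chart_at q) q)"
      using admissible_at_local_min[OF u S(1) k chart_at adm[OF chart_at] op(1) q min] by blast
    then have "q \<in> W" by (auto simp: W_def admissible_def tensor_sigma_eq[OF tA chart_at])
    then show False using WV q by blast
  qed
  then have "p \<in> W" using WV by blast
  then show ?thesis by (auto simp: W_def admissible_def tensor_sigma_eq[OF tA c])
qed

lemma solution_bounds:
  assumes u: "Ck_function \<A> 2 u" and comp: "compact (UNIV :: 'a set)"
    and S: "symmetric_tensor \<A> S" "Ck_tensor \<A> 0 S" and k: "1 \<le> k" "k \<le> CARD('n)"
    and adm: "\<And>c p. c \<in> \<A> \<Longrightarrow> p \<in> fst c \<Longrightarrow> admissible k (g c p) (S c p)"
    and f: "\<And>p. 0 < f p" and sol: "solves_equation \<A> g k S f u"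
    and m: "0 < m" "\<And>p. m \<le> root k (tensor_sigma S k p) / f p"
    and M: "\<And>p. root k (tensor_sigma S k p) / f p \<le> M"
  shows "ln m \<le> u x" "u x \<le> ln M"
proof -
  let ?A = "equation_tensor g S u"
  have tS: "tensor_field \<A> S" using S by (simp add: symmetric_tensor_def)
  have tA: "tensor_field \<A> ?A" by (rule equation_tensor_field[OF u tS])
  have eq: "root k (tensor_sigma ?A k p) = f p * exp (u p)" for p
    using sol chart_at[of p] by (simp add: solves_equation_def tensor_sigma_def)
  have pos: "0 < tensor_sigma ?A k p" for p
  proof -
    have "0 < root k (tensor_sigma ?A k p)" unfolding eq using f by simp
    then show ?thesis using k by (simp add: real_root_gt_0_iff)
  qed
  have admA: "admissible k (g c p) (?A c p)" if "c \<in> \<A>" "p \<in> fst c" for c p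
    by (rule admissible_everywhere[OF u comp S k(2) adm pos that])
  have cu: "continuous_on UNIV u" by (rule continuous_Ck_function[OF u])
  show "ln m \<le> u x"
  proof -
    obtain p where min: "\<And>q. u p \<le> u q"
      using continuous_attains_inf[OF comp _ cu] by auto
    have "tensor_sigma S k p \<le> tensor_sigma ?A k p"
      using admissible_at_local_min[OF u S(1) k(2) chart_at adm[OF chart_at] open_UNIV, of p] min
      by (simp add: tensor_sigma_eq[OF tS chart_at] tensor_sigma_eq[OF tA chart_at])
    then have "root k (tensor_sigma S k p) \<le> f p * exp (u p)"
      using k unfolding eq[symmetric] by simp
    then have "root k (tensor_sigma S k p) / f p \<le> exp (u p)"
      using f[of p] by (simp add: pos_divide_le_eq mult.commute)
    then have "m \<le> exp (u p)" using m(2)[of p] by linarith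
    then have "ln m \<le> ln (exp (u p))" using m(1) by (simp only: ln_le_cancel_iff exp_gt_zero)
    then have "ln m \<le> u p" by simp
    then show ?thesis using min[of x] by linarith
  qed
  show "u x \<le> ln M"
  proof -
    obtain p where max: "\<And>q. u q \<le> u p"
      using continuous_attains_sup[OF comp _ cu] by auto
    have "tensor_sigma ?A k p \<le> tensor_sigma S k p"
      using sym_eig_le_at_local_max[OF u S(1) k(2) chart_at admA[OF chart_at] open_UNIV, of p] max
      by (simp add: tensor_sigma_eq[OF tS chart_at] tensor_sigma_eq[OF tA chart_at])
    then have "f p * exp (u p) \<le> root k (tensor_sigma S k p)"
      using k unfolding eq[symmetric] by simp
    then have "exp (u p) \<le> root k (tensor_sigma S k p) / f p"
      using f[of p] by (simp add: pos_le_divide_eq mult.commute)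
    then have le: "exp (u p) \<le> M" using M[of p] by linarith
    then have "0 < M" using exp_gt_zero[of "u p"] by linarith
    then have "u p \<le> ln M" using le by (simp add: ln_ge_iff)
    then show ?thesis using max[of x] by linarith
  qed
qed

end

theorem proposition11:
  fixes \<A> :: "('a::{t2_space, second_countable_topology}, 'n::finite) chart set"
    and g S :: "('a, 'n) tensor02"
    and k :: nat
    and f :: "'a \<Rightarrow> real"
  assumes "smooth_atlas \<A>"
    and "compact (UNIV :: 'a set)"
    and "riemannian_metric \<A> g"
    and "1 \<le> k" "k \<le> CARD('n)"
    and "symmetric_tensor \<A> S" "Ck_tensor \<A> 0 S"
    and "in_Gamma_plus \<A> g k S"
    and "smooth_function \<A> f" "\<forall>p. 0 < f p"
  shows "\<exists>\<delta>\<^sub>1 \<delta>\<^sub>2 :: real. \<delta>\<^sub>1 < 0 \<and> 0 < \<delta>\<^sub>2 \<and>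
    (\<forall>u. Ck_function \<A> 2 u \<and> solves_equation \<A> g k S f u \<longrightarrow>
      (\<forall>x. \<delta>\<^sub>1 < u x \<and> u x < \<delta>\<^sub>2))"
proof -
  interpret riemannian_atlas \<A> g by unfold_locales (fact assms)+
  let ?h = "\<lambda>p. root k (tensor_sigma S k p) / f p"
  have tS: "tensor_field \<A> S" using assms by (simp add: symmetric_tensor_def)
  have adm: "admissible k (g c p) (S c p)" if "c \<in> \<A>" "p \<in> fst c" for c p
    using \<open>in_Gamma_plus \<A> g k S\<close> that eigenvalues_in_Gamma_plus_iff[OF \<open>k \<le> CARD('n)\<close>]
    unfolding in_Gamma_plus_def tensor_eigenvalues_def raise_index_def by blast
  have pos: "0 < ?h p" for p
  proof -
    have "0 < tensor_sigma S k p"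
      using adm[OF chart_at, of p] by (simp add: tensor_sigma_eq[OF tS chart_at] admissible_def)
    then show ?thesis using assms by (simp add: real_root_gt_0_iff)
  qed
  have "continuous_on UNIV (tensor_sigma S k)"
    using assms by (intro continuous_tensor_sigma continuous_on_entries)
  moreover have "continuous_on UNIV f"
    using \<open>smooth_function \<A> f\<close> by (intro continuous_Ck_function[of 0]) (simp add: smooth_function_def)
  ultimately have ch: "continuous_on UNIV ?h"
    using assms(10) by (intro continuous_intros) (auto simp: less_imp_neq[symmetric])
  obtain p where p: "\<And>q. ?h p \<le> ?h q"
    using continuous_attains_inf[OF \<open>compact UNIV\<close> _ ch] by auto
  obtain r where r: "\<And>q. ?h q \<le> ?h r"
    using continuous_attains_sup[OF \<open>compact UNIV\<close> _ ch] by auto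
  define \<delta>\<^sub>1 where "\<delta>\<^sub>1 = min (ln (?h p)) 0 - 1"
  define \<delta>\<^sub>2 where "\<delta>\<^sub>2 = max (ln (?h r)) 0 + 1"
  have "\<delta>\<^sub>1 < u x \<and> u x < \<delta>\<^sub>2"
    if u: "Ck_function \<A> 2 u" "solves_equation \<A> g k S f u" for u x
  proof -
    have fp: "0 < f p" for p using assms(10) by blast
    have "ln (?h p) \<le> u x" "u x \<le> ln (?h r)"
      using solution_bounds[OF u(1) assms(2,6,7,4,5) adm fp u(2) pos[of p] p r] by auto
    then show ?thesis by (auto simp: \<delta>\<^sub>1_def \<delta>\<^sub>2_def)
  qed
  moreover have "\<delta>\<^sub>1 < 0" "0 < \<delta>\<^sub>2" by (auto simp: \<delta>\<^sub>1_def \<delta>\<^sub>2_def)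
  ultimately show ?thesis by blast
qed

end
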